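(* For every finite partially ordered set $P$ there exists a constant $c(P)$ such that, for every $n\in\mathbb{N}$ and every family $\mathcal{F}\subseteq \mathcal{P}[n]$ which does not contain $P$ as an induced subposet, $$l(\mathcal{F})=\sum_{F\in\mathcal{F}}\frac{1}{\binom{n}{|F|}}\leq c(P).$$
   Context: $[n]=\{1,\dots,n\}$ and $\mathcal{P}[n]$ is the set of all subsets of $[n]$, ordered by inclusion; a family $\mathcal{F}\subseteq\mathcal{P}[n]$ is regarded as a poset under inclusion. A poset $P'$ contains a poset $P$ as an induced subposet if there is an injective map $\psi:P\to P'$ such that for all $x,y\in P$, $x\leq_P y$ if and only if $\psi(x)\leq_{P'}\psi(y)$. The quantity $l(\mathcal{F})=\sum_{F\in\mathcal{F}}1/\binom{n}{|F|}$ is called the Lubell mass of $\mathcal{F}$. *)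

theory Defs
  imports Complex_Main "HOL-Library.FuncSet"
begin

text \<open>A poset is a carrier together with a relation satisfying \<^const>\<open>partial_order_on\<close>.\<close>

definition contains_induced_subposet ::
  "'b set \<Rightarrow> 'b rel \<Rightarrow> 'a set \<Rightarrow> 'a rel \<Rightarrow> bool" where
  "contains_induced_subposet Q s P r \<longleftrightarrow>
     (\<exists>\<psi>. \<psi> \<in> P \<rightarrow> Q \<and> inj_on \<psi> P \<and>
          (\<forall>x\<in>P. \<forall>y\<in>P. (x, y) \<in> r \<longleftrightarrow> (\<psi> x, \<psi> y) \<in> s))"

abbreviation inclusion_order :: "'a set set \<Rightarrow> 'a set rel" where
  "inclusion_order F \<equiv> relation_of (\<subseteq>) F"

definition lubell_mass :: "nat \<Rightarrow> nat set set \<Rightarrow> real" where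
  "lubell_mass n F = (\<Sum>A\<in>F. 1 / real (n choose card A))"

end

theory Submission
  imports Defs "HOL-Combinatorics.Permutations"
begin

text \<open>Write the mass of a family in the cube over \<open>V\<close> as the expected number of its members on a random
maximal chain. The links of a family free of \<open>P\<close> in subcubes are again free of \<open>P\<close>, so by induction on
the dimension some constant \<open>K\<close> bounds the mass in all smaller subcubes, and \<open>K + 1\<close> bounds it in the
cube itself. The point of the proof is to improve such a bound: under the hypothesis that all subcubes
have mass at most \<open>K + 1\<close>, the mass is shown to be at most a constant plus a constant times \<open>T\<close>, as
soon as \<open>2 ^ T\<close> exceeds a fixed cubic polynomial in \<open>K\<close>. Since powers of two outgrow cubes, \<open>T\<close> can be
chosen so that the improved bound is \<open>K\<close> itself, and the induction closes
(\<open>mass_bounded_of_order_free\<close>). The improvement has two ingredients.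

\<^item> A dyadic window of levels \<open>{M..2 M}\<close> in the lower half of the cube carries bounded mass
(\<open>mass_dyadic_window_bounded\<close>). Unions of initial segments of \<open>m\<close> disjoint random chains form a
grid on which inclusion is the coordinatewise order, and a family free of \<open>P\<close> meets the grid in a set of
points avoiding a pattern with distinct coordinates. The Klazar--Marcus theorem, the higher-dimensional
form of the Marcus--Tardos theorem (\<open>hypermatrix_avoiding_rank_pattern\<close>), says that such a set has
at most a constant times \<open>M ^ (m - 1)\<close> points, which is the order of the number of grid points on one
level.

\<^item> If \<open>m = card P\<close> blocks of levels have mass at least \<open>1\<close> each, and each block starts at least \<open>C\<close> times
higher than the previous one ends, with \<open>C\<close> of the order of \<open>K ^ 3\<close>, then the family contains \<open>P\<close>
(\<open>separated_blocks_contain_order\<close>). The members are built as \<open>A\<^sub>j = \<Union>{D\<^sub>q | q \<le> j in P}\<close> with disjoint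
sets \<open>D\<^sub>0, D\<^sub>1, \<dots>\<close> chosen one after the other. The mass of a later block above \<open>D\<close>, or avoiding \<open>D\<close>,
is a martingale when \<open>D\<close> grows by random elements. Its values lie in \<open>[0, K + 1]\<close>, and its variance
accumulates at an increasing rate up to the level where the block starts; so during the first
fraction \<open>1 / C\<close> of the way it hardly moves. Hence the first increments can be chosen so that the
next member is in the family while the masses of all later blocks stay close to their initial values.

Together they bound the lower half: choosing blocks greedily with \<open>C = 2 ^ T\<close>, fewer than \<open>m\<close> heavy
blocks fit, and each block with the gap after it costs at most \<open>2 + T W\<close>, where \<open>W\<close> bounds a dyadic
window. The upper half follows by complementation, which reverses the order of \<open>P\<close>.\<close>

section \<open>Sets of grid points avoiding a pattern\<close>

text \<open>The pattern is a finite set \<open>Q\<close> of points given only by their ranks \<open>\<rho> i q\<close> in each coordinate \<open>i\<close>. Only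
strict inequalities have to be respected; for ranks that are injective in every coordinate this is the
notion of containing a permutation hypermatrix.\<close>

definition contains_rank_pattern ::
  "'i set \<Rightarrow> 'q set \<Rightarrow> ('i \<Rightarrow> 'q \<Rightarrow> nat) \<Rightarrow> ('i \<Rightarrow> nat) set \<Rightarrow> bool" where
  "contains_rank_pattern I Q \<rho> S \<longleftrightarrow>
     (\<exists>y. (\<forall>q\<in>Q. y q \<in> S) \<and>
          (\<forall>i\<in>I. \<forall>a\<in>Q. \<forall>b\<in>Q. \<rho> i a < \<rho> i b \<longrightarrow> y a i < y b i))"

text \<open>A point goes to the element of \<open>B\<close> whose position is the number of points of smaller rank.\<close>

lemma strict_rank_embedding:
  fixes r :: "'q \<Rightarrow> nat" and B :: "nat set"
  assumes "finite Q" "finite B" "card Q \<le> card B"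
  shows "\<exists>h. (\<forall>q\<in>Q. h q \<in> B) \<and> (\<forall>a\<in>Q. \<forall>b\<in>Q. r a < r b \<longrightarrow> h a < h b)"
proof -
  define pos where "pos a = card {c\<in>Q. r c < r a}" for a
  define h where "h a = sorted_list_of_set B ! pos a" for a
  have len: "length (sorted_list_of_set B) = card B" by simp
  have pos_less: "pos a < card B" if "a \<in> Q" for a
  proof -
    have "{c\<in>Q. r c < r a} \<subset> Q" using that by auto
    then have "pos a < card Q" unfolding pos_def using assms(1) by (rule psubset_card_mono[rotated])
    then show ?thesis using assms(3) by simp
  qed
  have pos_mono: "pos a < pos b" if "a \<in> Q" "b \<in> Q" "r a < r b" for a b
    unfolding pos_def
  proof (rule psubset_card_mono)
    show "finite {c \<in> Q. r c < r b}" using assms(1) by simp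
    show "{c \<in> Q. r c < r a} \<subset> {c \<in> Q. r c < r b}" using that by auto
  qed
  have "h q \<in> B" if "q \<in> Q" for q
    unfolding h_def using pos_less[OF that] len assms(2)
    by (metis nth_mem set_sorted_list_of_set)
  moreover have "h a < h b" if "a \<in> Q" "b \<in> Q" "r a < r b" for a b
    unfolding h_def using pos_mono[OF that] pos_less[OF that(2)] len
    by (metis sorted_wrt_nth_less strict_sorted_list_of_set)
  ultimately show ?thesis by blast
qed

lemma div_less_imp_less: "x div s < y div s \<Longrightarrow> x < (y::nat)"
  by (meson div_le_mono leD leI)

lemma div_in_box:
  fixes s :: nat
  assumes "x \<in> S" "S \<subseteq> PiE I (\<lambda>_. {..<s * N})"
  shows "restrict (\<lambda>i. x i div s) I \<in> PiE I (\<lambda>_. {..<N})"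
proof -
  have "x i div s < N" if "i \<in> I" for i
    using assms that less_mult_imp_div_less[of "x i" N s] by (auto simp: mult.commute)
  then show ?thesis by auto
qed

text \<open>Strict inequalities between blocks carry over to arbitrary points of the blocks, so contracting to
blocks of side \<open>s\<close> creates no pattern.\<close>

lemma rank_pattern_lift_blocks:
  assumes "contains_rank_pattern I Q \<rho> ((\<lambda>x. restrict (\<lambda>i. x i div s) I) ` S)"
  shows "contains_rank_pattern I Q \<rho> S"
proof -
  let ?\<beta> = "\<lambda>x. restrict (\<lambda>i. x i div s) I"
  obtain y where y: "\<forall>q\<in>Q. y q \<in> ?\<beta> ` S"
    "\<forall>i\<in>I. \<forall>a\<in>Q. \<forall>b\<in>Q. \<rho> i a < \<rho> i b \<longrightarrow> y a i < y b i"
    using assms unfolding contains_rank_pattern_def by blast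
  from y(1) have "\<forall>q\<in>Q. \<exists>x. x \<in> S \<and> y q = ?\<beta> x" by (simp add: image_iff Bex_def)
  from bchoice[OF this] obtain x where x: "\<forall>q\<in>Q. x q \<in> S \<and> y q = ?\<beta> (x q)" ..
  have "x a i < x b i" if "i \<in> I" "a \<in> Q" "b \<in> Q" "\<rho> i a < \<rho> i b" for i a b
  proof (rule div_less_imp_less)
    have "y a i < y b i" using y(2) that by blast
    then show "x a i div s < x b i div s" using x that by simp
  qed
  moreover have "\<forall>q\<in>Q. x q \<in> S" using x by simp
  ultimately show ?thesis unfolding contains_rank_pattern_def by blast
qed

text \<open>The blocks in \<open>W\<close> all offer the same set \<open>B\<close> of values in coordinate \<open>i\<close>. When \<open>B\<close> has enough elements,
the point taken from each block can be given any prescribed rank in coordinate \<open>i\<close>, so a pattern in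
the other coordinates already suffices.\<close>

lemma rank_pattern_lift_slab:
  fixes S :: "('i \<Rightarrow> nat) set" and s :: nat and I :: "'i set"
  defines "\<beta> \<equiv> (\<lambda>x. restrict (\<lambda>i. x i div s) I)"
  assumes Q: "finite Q" and i: "i \<in> I" and B: "finite B" "card Q \<le> card B"
    and vals: "\<forall>b\<in>W. (\<lambda>x. x i) ` {x\<in>S. \<beta> x = b} = B"
    and pat: "contains_rank_pattern (I - {i}) Q \<rho> ((\<lambda>b. restrict b (I - {i})) ` W)"
  shows "contains_rank_pattern I Q \<rho> S"
proof -
  obtain y where y: "\<forall>q\<in>Q. y q \<in> (\<lambda>b. restrict b (I - {i})) ` W"
    "\<forall>j\<in>I - {i}. \<forall>a\<in>Q. \<forall>b\<in>Q. \<rho> j a < \<rho> j b \<longrightarrow> y a j < y b j"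
    using pat unfolding contains_rank_pattern_def by blast
  from y(1) have "\<forall>q\<in>Q. \<exists>b. b \<in> W \<and> y q = restrict b (I - {i})" by (simp add: image_iff Bex_def)
  from bchoice[OF this] obtain w where w: "\<forall>q\<in>Q. w q \<in> W \<and> y q = restrict (w q) (I - {i})" ..
  obtain h where h: "\<forall>q\<in>Q. h q \<in> B" "\<forall>a\<in>Q. \<forall>b\<in>Q. \<rho> i a < \<rho> i b \<longrightarrow> h a < h b"
    using strict_rank_embedding[OF Q B, of "\<rho> i"] by blast
  have "\<exists>x. x \<in> S \<and> \<beta> x = w q \<and> x i = h q" if "q \<in> Q" for q
  proof -
    have "w q \<in> W" "h q \<in> B" using w h(1) that by blast+
    then have "h q \<in> (\<lambda>x. x i) ` {x\<in>S. \<beta> x = w q}" using vals by blast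
    then obtain x where "h q = x i" "x \<in> {x\<in>S. \<beta> x = w q}" by (rule imageE)
    then have "x \<in> S \<and> \<beta> x = w q \<and> x i = h q" by simp
    then show ?thesis by (intro exI[of _ x])
  qed
  then have "\<forall>q\<in>Q. \<exists>x. x \<in> S \<and> \<beta> x = w q \<and> x i = h q" by simp
  from bchoice[OF this] obtain x where x: "\<forall>q\<in>Q. x q \<in> S \<and> \<beta> (x q) = w q \<and> x q i = h q" ..
  have "x a j < x b j" if "j \<in> I" "a \<in> Q" "b \<in> Q" "\<rho> j a < \<rho> j b" for j a b
  proof (cases "j = i")
    case True
    then have "h a < h b" using h(2) that by blast
    then show ?thesis using True x that(2,3) by simp
  next
    case False
    have "y a j < y b j" using y(2) that False by blast
    then have "w a j < w b j" using w that False by simp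
    moreover have "w a j = x a j div s" "w b j = x b j div s"
      using x[rule_format, OF that(2), THEN conjunct2, THEN conjunct1, THEN fun_cong, of j]
        x[rule_format, OF that(3), THEN conjunct2, THEN conjunct1, THEN fun_cong, of j] that(1)
      unfolding \<beta>_def by simp_all
    ultimately show ?thesis using div_less_imp_less[of "x a j" s "x b j"] by simp
  qed
  moreover have "\<forall>q\<in>Q. x q \<in> S" using x by simp
  ultimately show ?thesis unfolding contains_rank_pattern_def by blast
qed

text \<open>A block is wide in direction \<open>i\<close> when its points take at least \<open>card Q\<close> values in that coordinate.
Wide blocks are classified by this set of values, which lies in an interval of length \<open>s\<close> and thus allows at
most \<open>N * 2 ^ s\<close> classes. By \<open>rank_pattern_lift_slab\<close> the projection of each class along
direction \<open>i\<close> avoids the pattern in one dimension less.\<close>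

lemma card_wide_blocks:
  fixes S :: "('i \<Rightarrow> nat) set" and s :: nat and I :: "'i set"
  defines "\<beta> \<equiv> (\<lambda>x. restrict (\<lambda>i. x i div s) I)"
  assumes I: "finite I" and Q: "finite Q" "Q \<noteq> {}" and i: "i \<in> I" and s: "s > 0"
    and S: "S \<subseteq> PiE I (\<lambda>_. {..<s * N})" and avoid: "\<not> contains_rank_pattern I Q \<rho> S"
    and IH: "\<And>S'. S' \<subseteq> PiE (I - {i}) (\<lambda>_. {..<N}) \<Longrightarrow>
               \<not> contains_rank_pattern (I - {i}) Q \<rho> S' \<Longrightarrow> card S' \<le> c"
  shows "card {b \<in> \<beta> ` S. card Q \<le> card ((\<lambda>x. x i) ` {x\<in>S. \<beta> x = b})} \<le> N * 2 ^ s * c"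
proof -
  define val where "val b = (\<lambda>x. x i) ` {x\<in>S. \<beta> x = b}" for b
  define W where "W = {b \<in> \<beta> ` S. card Q \<le> card (val b)}"
  define keys where "keys = (\<Union>\<tau><N. Pow {s * \<tau>..<s * \<tau> + s})"
  have finS: "finite S" using S I by (auto intro: finite_subset finite_PiE)
  have finval: "finite (val b)" for b unfolding val_def using finS by simp
  have \<beta>I: "\<beta> x \<in> PiE I (\<lambda>_. {..<N})" if "x \<in> S" for x
    unfolding \<beta>_def by (rule div_in_box[OF that S])
  have val_div: "v div s = b i" if "v \<in> val b" for v b
    using that i unfolding val_def \<beta>_def by auto
  have val_key: "val b \<in> keys" if "b \<in> \<beta> ` S" for b
  proof -
    have "b \<in> PiE I (\<lambda>_. {..<N})" using that \<beta>I by auto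
    from PiE_mem[OF this i] have "b i < N" by simp
    moreover have "v \<in> {s * b i..<s * b i + s}" if "v \<in> val b" for v
    proof -
      have "s * (v div s) \<le> v" "v < s * (v div s) + s"
        using s mult_div_mod_eq[of s v] mod_less_divisor[of s v] by linarith+
      then show ?thesis using val_div[OF that] by simp
    qed
    ultimately show ?thesis unfolding keys_def by blast
  qed
  have fink: "finite keys" unfolding keys_def by simp
  have "card keys \<le> (\<Sum>\<tau><N. card (Pow {s * \<tau>..<s * \<tau> + s}))"
    unfolding keys_def by (rule card_UN_le) simp
  also have "\<dots> = N * 2 ^ s" by (simp add: card_Pow)
  finally have cardk: "card keys \<le> N * 2 ^ s" .
  \<comment> \<open>Coordinate \<open>i\<close> of a block can be read off from its values, so projecting along \<open>i\<close> is injective on a class.\<close>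
  have cls: "card {b\<in>W. val b = B} \<le> c" for B
  proof (cases "{b\<in>W. val b = B} = {}")
    case True
    show ?thesis unfolding True by simp
  next
    case False
    define C where "C = {b\<in>W. val b = B}"
    have cardB: "card Q \<le> card B" using False unfolding W_def by auto
    then have "B \<noteq> {}" using Q by (auto simp: card_gt_0_iff)
    then obtain v where v: "v \<in> B" by blast
    have finB: "finite B" using False finval by auto
    have C_PiE: "C \<subseteq> PiE I (\<lambda>_. {..<N})" using \<beta>I unfolding C_def W_def by auto
    have Ci: "b i = v div s" if "b \<in> C" for b using that v val_div unfolding C_def by auto
    have inj: "inj_on (\<lambda>b. restrict b (I - {i})) C"
    proof (rule inj_onI)
      fix b b' assume bb: "b \<in> C" "b' \<in> C" "restrict b (I - {i}) = restrict b' (I - {i})"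
      show "b = b'"
      proof (rule PiE_ext)
        show "b \<in> PiE I (\<lambda>_. {..<N})" "b' \<in> PiE I (\<lambda>_. {..<N})" using bb C_PiE by auto
        fix j assume "j \<in> I"
        then show "b j = b' j"
          using Ci[OF bb(1)] Ci[OF bb(2)] fun_cong[OF bb(3), of j] by (cases "j = i") simp_all
      qed
    qed
    have "\<not> contains_rank_pattern (I - {i}) Q \<rho> ((\<lambda>b. restrict b (I - {i})) ` C)"
    proof
      assume "contains_rank_pattern (I - {i}) Q \<rho> ((\<lambda>b. restrict b (I - {i})) ` C)"
      from rank_pattern_lift_slab[OF Q(1) i finB cardB _ this, of S s]
      have "contains_rank_pattern I Q \<rho> S" unfolding C_def val_def \<beta>_def by simp
      then show False using avoid by simp
    qed
    moreover have "(\<lambda>b. restrict b (I - {i})) ` C \<subseteq> PiE (I - {i}) (\<lambda>_. {..<N})"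
    proof (rule image_subsetI)
      fix b assume "b \<in> C"
      then have "b \<in> PiE I (\<lambda>_. {..<N})" using C_PiE by blast
      from PiE_mem[OF this] show "restrict b (I - {i}) \<in> PiE (I - {i}) (\<lambda>_. {..<N})" by simp
    qed
    ultimately have "card ((\<lambda>b. restrict b (I - {i})) ` C) \<le> c" using IH by blast
    then show ?thesis using card_image[OF inj] unfolding C_def by simp
  qed
  have "val b \<in> keys" if "b \<in> W" for b using val_key that unfolding W_def by simp
  then have "W = (\<Union>B\<in>keys. {b\<in>W. val b = B})" by blast
  then have "card W \<le> (\<Sum>B\<in>keys. card {b\<in>W. val b = B})"
    using card_UN_le[OF fink, of "\<lambda>B. {b\<in>W. val b = B}"] by simp
  also have "\<dots> \<le> card keys * c" using sum_bounded_above[of keys _ c] cls by simp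
  also have "\<dots> \<le> N * 2 ^ s * c" using cardk by (rule mult_right_mono) simp
  finally show ?thesis unfolding W_def val_def .
qed

lemma card_fibre_bounds:
  fixes S :: "('i \<Rightarrow> nat) set" and s :: nat and I :: "'i set"
  defines "\<beta> \<equiv> (\<lambda>x. restrict (\<lambda>i. x i div s) I)"
  assumes I: "finite I" and s: "s > 0" and S: "S \<subseteq> PiE I (\<lambda>_. {..<s * N})"
    and le: "\<And>i. i \<in> I \<Longrightarrow> card ((\<lambda>x. x i) ` {x\<in>S. \<beta> x = b}) \<le> k"
  shows "card {x\<in>S. \<beta> x = b} \<le> k ^ card I"
proof -
  have finS: "finite S" using S I by (auto intro: finite_subset finite_PiE)
  have sub: "{x\<in>S. \<beta> x = b} \<subseteq> PiE I (\<lambda>i. (\<lambda>x. x i) ` {x\<in>S. \<beta> x = b})"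
    using S by (auto simp: PiE_def)
  have "card {x\<in>S. \<beta> x = b} \<le> card (PiE I (\<lambda>i. (\<lambda>x. x i) ` {x\<in>S. \<beta> x = b}))"
    by (rule card_mono[OF _ sub]) (use I finS in \<open>auto intro!: finite_PiE\<close>)
  also have "\<dots> = (\<Prod>i\<in>I. card ((\<lambda>x. x i) ` {x\<in>S. \<beta> x = b}))" by (rule card_PiE[OF I])
  also have "\<dots> \<le> (\<Prod>i\<in>I. k)" by (rule prod_mono) (use le in auto)
  also have "\<dots> = k ^ card I" by simp
  finally show ?thesis .
qed

lemma card_fibre_values:
  fixes S :: "('i \<Rightarrow> nat) set" and s :: nat and I :: "'i set"
  assumes s: "s > 0" and i: "i \<in> I"
  shows "card ((\<lambda>x. x i) ` {x\<in>S. restrict (\<lambda>i. x i div s) I = b}) \<le> s"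
proof -
  have "(\<lambda>x. x i) ` {x\<in>S. restrict (\<lambda>i. x i div s) I = b} \<subseteq> {s * b i..<s * b i + s}"
  proof
    fix v assume "v \<in> (\<lambda>x. x i) ` {x\<in>S. restrict (\<lambda>i. x i div s) I = b}"
    then have "v div s = b i" using i by auto
    moreover have "s * (v div s) \<le> v" "v < s * (v div s) + s"
        using s mult_div_mod_eq[of s v] mod_less_divisor[of s v] by linarith+
    ultimately show "v \<in> {s * b i..<s * b i + s}" by simp
  qed
  from card_mono[OF _ this] show ?thesis by simp
qed

text \<open>A block that is wide in no direction lies in a box with sides below \<open>card Q\<close>. There are few wide
blocks by \<open>card_wide_blocks\<close>, so for them the trivial bound \<open>s ^ card I\<close> is good enough.\<close>

lemma rank_pattern_recursion:
  fixes S :: "('i \<Rightarrow> nat) set" and s :: nat and I :: "'i set"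
  defines "\<beta> \<equiv> (\<lambda>x. restrict (\<lambda>i. x i div s) I)"
  assumes I: "finite I" and Q: "finite Q" "Q \<noteq> {}" and s: "s > 0"
    and S: "S \<subseteq> PiE I (\<lambda>_. {..<s * N})" and avoid: "\<not> contains_rank_pattern I Q \<rho> S"
    and IH: "\<And>i S'. i \<in> I \<Longrightarrow> S' \<subseteq> PiE (I - {i}) (\<lambda>_. {..<N}) \<Longrightarrow>
               \<not> contains_rank_pattern (I - {i}) Q \<rho> S' \<Longrightarrow> card S' \<le> c"
  shows "card S \<le> card Q ^ card I * card (\<beta> ` S) + card I * (N * 2 ^ s * c) * s ^ card I"
proof -
  define W where "W i = {b \<in> \<beta> ` S. card Q \<le> card ((\<lambda>x. x i) ` {x\<in>S. \<beta> x = b})}" for i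
  define U where "U = (\<Union>i\<in>I. W i)"
  have finS: "finite S" using S I by (auto intro: finite_subset finite_PiE)
  have W: "card (W i) \<le> N * 2 ^ s * c" if "i \<in> I" for i
    unfolding W_def \<beta>_def by (rule card_wide_blocks[OF I Q that s S avoid IH[OF that]])
  have finU: "finite U" unfolding U_def W_def using finS I by auto
  have "card U \<le> (\<Sum>i\<in>I. card (W i))" unfolding U_def by (rule card_UN_le[OF I])
  also have "\<dots> \<le> card I * (N * 2 ^ s * c)" using sum_bounded_above[of I "\<lambda>i. card (W i)", OF W] by simp
  finally have cU: "card U \<le> card I * (N * 2 ^ s * c)" .
  have "S = (\<Union>b\<in>\<beta> ` S. {x\<in>S. \<beta> x = b})" by auto
  then have "card S \<le> (\<Sum>b\<in>\<beta> ` S. card {x\<in>S. \<beta> x = b})"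
    using card_UN_le[of "\<beta> ` S" "\<lambda>b. {x\<in>S. \<beta> x = b}"] finS by simp
  also have "\<dots> \<le> (\<Sum>b\<in>\<beta> ` S. card Q ^ card I + (if b \<in> U then s ^ card I else 0))"
  proof (rule sum_mono)
    fix b assume b: "b \<in> \<beta> ` S"
    show "card {x\<in>S. \<beta> x = b} \<le> card Q ^ card I + (if b \<in> U then s ^ card I else 0)"
    proof (cases "b \<in> U")
      case True
      have "card {x\<in>S. \<beta> x = b} \<le> s ^ card I"
        unfolding \<beta>_def by (rule card_fibre_bounds[OF I s S]) (rule card_fibre_values[OF s])
      then show ?thesis using True by simp
    next
      case False
      have "card {x\<in>S. \<beta> x = b} \<le> card Q ^ card I"
        unfolding \<beta>_def
      proof (rule card_fibre_bounds[OF I s S])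
        fix i assume "i \<in> I"
        then show "card ((\<lambda>x. x i) ` {x\<in>S. restrict (\<lambda>i. x i div s) I = b}) \<le> card Q"
          using False b unfolding U_def W_def \<beta>_def by auto
      qed
      then show ?thesis using False by simp
    qed
  qed
  also have "\<dots> = card Q ^ card I * card (\<beta> ` S) + (\<Sum>b\<in>\<beta> ` S. if b \<in> U then s ^ card I else 0)"
    by (simp add: sum.distrib)
  also have "(\<Sum>b\<in>\<beta> ` S. if b \<in> U then s ^ card I else 0) = card (\<beta> ` S \<inter> U) * s ^ card I"
    using finS by (simp add: sum.If_cases)
  also have "card (\<beta> ` S \<inter> U) \<le> card U" by (rule card_mono[OF finU]) simp
  finally show ?thesis using cU
    by (meson add_left_mono le_trans mult_le_mono1)
qed

text \<open>The Klazar--Marcus theorem. Let \<open>d = card I - 1\<close>. By induction on the dimension, the wide blocks of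
side \<open>s\<close> contribute at most a constant times \<open>N ^ d\<close>, while the contracted set contributes with a factor
\<open>k ^ (d + 1)\<close>, where \<open>k = card Q\<close>. For \<open>s = 2 k\<^sup>2\<close> this factor is at most \<open>s ^ d / 2\<close>, so the recursion sums to a
bound of order \<open>N ^ d\<close>. It is run along side lengths \<open>s ^ t\<close> and then extended to all \<open>N\<close>.\<close>

theorem hypermatrix_avoiding_rank_pattern:
  fixes \<rho> :: "'i \<Rightarrow> 'q \<Rightarrow> nat"
  assumes Q: "finite Q" and "finite I" "I \<noteq> {}"
  shows "\<exists>c. \<forall>N S. S \<subseteq> PiE I (\<lambda>_. {..<N}) \<longrightarrow> \<not> contains_rank_pattern I Q \<rho> S \<longrightarrow>
               card S \<le> c * N ^ (card I - 1)"
  using assms(2,3)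
proof (induction "card I" arbitrary: I rule: less_induct)
  case less
  note I = \<open>finite I\<close> \<open>I \<noteq> {}\<close>
  show ?case
  proof (cases "Q = {}")
    case True
    then show ?thesis by (auto simp: contains_rank_pattern_def)
  next
    case Qne: False
    show ?thesis
    proof (cases "card I = 1")
      case True
      then obtain i where i: "I = {i}" by (auto simp: card_1_singleton_iff)
      have "card S \<le> card Q * N ^ (card I - 1)"
        if S: "S \<subseteq> PiE I (\<lambda>_. {..<N})" and av: "\<not> contains_rank_pattern I Q \<rho> S" for N S
      proof (rule ccontr)
        assume "\<not> ?thesis"
        then have big: "card Q \<le> card S" using True by simp
        have finS: "finite S" using S I by (auto intro: finite_subset finite_PiE)
        have "inj_on (\<lambda>x. x i) S"
        proof (rule inj_onI)
          fix x y assume "x \<in> S" "y \<in> S" "x i = y i"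
          then show "x = y" using S i by (intro PiE_ext[of x I "\<lambda>_. {..<N}" y]) auto
        qed
        then have "card ((\<lambda>x. x i) ` S) = card S" by (rule card_image)
        then obtain h where h: "\<forall>q\<in>Q. h q \<in> (\<lambda>x. x i) ` S"
          "\<forall>a\<in>Q. \<forall>b\<in>Q. \<rho> i a < \<rho> i b \<longrightarrow> h a < h b"
          using strict_rank_embedding[OF Q, of "(\<lambda>x. x i) ` S" "\<rho> i"] finS big by auto
        from h(1) have "\<forall>q\<in>Q. \<exists>x. x \<in> S \<and> h q = x i" by (simp add: image_iff Bex_def)
        from bchoice[OF this] obtain x where "\<forall>q\<in>Q. x q \<in> S \<and> h q = x q i" ..
        then have "contains_rank_pattern I Q \<rho> S"
          unfolding contains_rank_pattern_def using h(2) i by (intro exI[of _ x]) auto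
        then show False using av by simp
      qed
      then show ?thesis by blast
    next
      case False
      define D where "D = card I"
      define d where "d = D - 1"
      define k where "k = card Q"
      define s where "s = 2 * k ^ 2"
      have "card I > 0" using I by (simp add: card_gt_0_iff)
      then have D: "D = Suc d" "d \<ge> 1" using False unfolding D_def d_def by linarith+
      have k: "k \<ge> 1" unfolding k_def using Q Qne by (simp add: Suc_leI card_gt_0_iff)
      have s2: "s \<ge> 2" unfolding s_def using k by simp
      have "\<forall>i\<in>I. \<exists>c. \<forall>N S. S \<subseteq> PiE (I - {i}) (\<lambda>_. {..<N}) \<longrightarrow>
          \<not> contains_rank_pattern (I - {i}) Q \<rho> S \<longrightarrow> card S \<le> c * N ^ (card (I - {i}) - 1)"
      proof
        fix i assume i: "i \<in> I"
        have d: "card (I - {i}) = d" using i I D unfolding D_def by simp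
        then have "card (I - {i}) < card I" using D unfolding D_def by simp
        moreover have "I - {i} \<noteq> {}"
        proof
          assume "I - {i} = {}"
          then have "card (I - {i}) = 0" by (simp only: card.empty)
          then show False using d D(2) by simp
        qed
        ultimately
        show "\<exists>c. \<forall>N S. S \<subseteq> PiE (I - {i}) (\<lambda>_. {..<N}) \<longrightarrow>
          \<not> contains_rank_pattern (I - {i}) Q \<rho> S \<longrightarrow> card S \<le> c * N ^ (card (I - {i}) - 1)"
          using less.hyps[of "I - {i}"] I by blast
      qed
      then obtain cc where cc: "\<And>i N S. i \<in> I \<Longrightarrow> S \<subseteq> PiE (I - {i}) (\<lambda>_. {..<N}) \<Longrightarrow>
          \<not> contains_rank_pattern (I - {i}) Q \<rho> S \<Longrightarrow> card S \<le> cc i * N ^ (card (I - {i}) - 1)"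
        by metis
      define c' where "c' = (\<Sum>i\<in>I. cc i)"
      have sub: "card S \<le> c' * N ^ (d - 1)"
        if "i \<in> I" "S \<subseteq> PiE (I - {i}) (\<lambda>_. {..<N})" "\<not> contains_rank_pattern (I - {i}) Q \<rho> S" for i N S
      proof -
        have "card (I - {i}) = d" using that I D unfolding D_def by simp
        then have "card S \<le> cc i * N ^ (d - 1)" using cc[OF that] by simp
        also have "cc i \<le> c'" unfolding c'_def using that I by (intro member_le_sum) auto
        finally show ?thesis by simp
      qed
      define C where "C = D * 2 ^ s * c' * s ^ D"
      define c where "c = C + 1"
      \<comment> \<open>The choice of \<open>s\<close>: \<open>s ^ d = 2 ^ d * k ^ (2 * d)\<close> and \<open>D \<le> 2 * d\<close>.\<close>
      have key: "2 * k ^ D \<le> s ^ d"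
      proof -
        have "2 * k ^ D \<le> 2 ^ d * k ^ D" using D(2) by (intro mult_right_mono) (auto simp: self_le_power)
        also have "\<dots> \<le> 2 ^ d * k ^ (2 * d)" using D k by (intro mult_left_mono power_increasing) auto
        also have "\<dots> = s ^ d" unfolding s_def by (simp add: power_mult_distrib power_mult)
        finally show ?thesis .
      qed
      have pow: "card S \<le> c * (s ^ t) ^ d"
        if "S \<subseteq> PiE I (\<lambda>_. {..<s ^ t})" "\<not> contains_rank_pattern I Q \<rho> S" for t S
        using that
      proof (induction t arbitrary: S)
        case 0
        have "card S \<le> card (PiE I (\<lambda>_. {..<s ^ 0}))"
          using 0(1) I by (intro card_mono finite_PiE) auto
        also have "\<dots> = 1" using I by (simp add: card_PiE)
        finally show ?case unfolding c_def by simp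
      next
        case (Suc t)
        define N where "N = s ^ t"
        let ?\<beta> = "\<lambda>x. restrict (\<lambda>i. x i div s) I"
        have S: "S \<subseteq> PiE I (\<lambda>_. {..<s * N})" using Suc.prems(1) unfolding N_def by simp
        have "?\<beta> ` S \<subseteq> PiE I (\<lambda>_. {..<N})"
          by (rule image_subsetI) (rule div_in_box[OF _ S])
        moreover have "\<not> contains_rank_pattern I Q \<rho> (?\<beta> ` S)"
          using rank_pattern_lift_blocks Suc.prems(2) by blast
        ultimately have contracted: "card (?\<beta> ` S) \<le> c * N ^ d" using Suc.IH unfolding N_def by blast
        have "card S \<le> card Q ^ card I * card (?\<beta> ` S) + card I * (N * 2 ^ s * (c' * N ^ (d - 1))) * s ^ card I"
          by (rule rank_pattern_recursion[OF I(1) Q Qne _ S Suc.prems(2)]) (use s2 sub in auto)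
        also have "card Q ^ card I * card (?\<beta> ` S) \<le> k ^ D * (c * N ^ d)"
          using contracted unfolding k_def D_def by (rule mult_left_mono) simp
        also have "card I * (N * 2 ^ s * (c' * N ^ (d - 1))) * s ^ card I = C * (N * N ^ (d - 1))"
          unfolding C_def D_def by simp
        also have "N * N ^ (d - 1) = N ^ d" using D(2) by (simp add: power_eq_if)
        finally have "card S \<le> (k ^ D * c + C) * N ^ d" by (simp add: algebra_simps)
        also have "\<dots> \<le> (c * s ^ d) * N ^ d"
        proof (rule mult_right_mono)
          have "1 \<le> k ^ D" using k by simp
          then have "c * 1 \<le> c * k ^ D" by (intro mult_left_mono) auto
          moreover have "c * (2 * k ^ D) \<le> c * s ^ d" using key by (intro mult_left_mono) auto
          ultimately show "k ^ D * c + C \<le> c * s ^ d" unfolding c_def by (simp add: algebra_simps)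
        qed simp
        finally show ?case unfolding N_def by (simp add: power_mult_distrib algebra_simps)
      qed
      have "card S \<le> (c * s ^ d) * N ^ (card I - 1)"
        if S: "S \<subseteq> PiE I (\<lambda>_. {..<N})" and av: "\<not> contains_rank_pattern I Q \<rho> S" for N S
      proof (cases "N = 0")
        case True
        then have "S = {}" using S I by (auto simp: PiE_eq_empty_iff)
        then show ?thesis by simp
      next
        case False
        have "\<exists>t. N \<le> s ^ t \<and> s ^ t \<le> s * N"
        proof -
          define t where "t = (LEAST t. N \<le> s ^ t)"
          have ex: "N \<le> s ^ N" using s2
            by (meson less_exp less_imp_le order_trans power_mono zero_le)
          have t1: "N \<le> s ^ t" unfolding t_def by (rule LeastI[of "\<lambda>t. N \<le> s ^ t", OF ex])
          have "s ^ t \<le> s * N"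
          proof (cases t)
            case 0
            then show ?thesis using False s2 by simp
          next
            case (Suc u)
            then have "\<not> N \<le> s ^ u" unfolding t_def using not_less_Least[of u "\<lambda>t. N \<le> s ^ t"] by simp
            then show ?thesis using Suc by simp
          qed
          then show ?thesis using t1 by blast
        qed
        then obtain t where t: "N \<le> s ^ t" "s ^ t \<le> s * N" by blast
        have "S \<subseteq> PiE I (\<lambda>_. {..<s ^ t})" using S t(1) PiE_mono[of I "\<lambda>_. {..<N}" "\<lambda>_. {..<s ^ t}"] by auto
        then have "card S \<le> c * (s ^ t) ^ d" using pow av by blast
        also have "\<dots> \<le> c * (s * N) ^ d" using t(2) by (intro mult_left_mono power_mono) auto
        finally show ?thesis using d_def D_def by (simp add: power_mult_distrib algebra_simps)
      qed
      then show ?thesis by blast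
    qed
  qed
qed

section \<open>Lubell mass, links and subcubes\<close>

text \<open>The Lubell mass over an arbitrary ground set, as needed for passing to subcubes.\<close>

definition mass :: "'a set \<Rightarrow> 'a set set \<Rightarrow> real" where
  "mass V F = (\<Sum>A\<in>F. 1 / real (card V choose card A))"

text \<open>The trace of \<open>F\<close> on the subcube of all sets that contain \<open>Y\<close> and avoid \<open>X\<close>, with \<open>Y\<close> removed from
every member so that it is a family over the complement of \<open>Y \<union> X\<close>.\<close>

definition link :: "'a set set \<Rightarrow> 'a set \<Rightarrow> 'a set \<Rightarrow> 'a set set" where
  "link F Y X = {D. D \<inter> (Y \<union> X) = {} \<and> Y \<union> D \<in> F}"

text \<open>One step of the random chain: the expectation of \<open>g\<close> after a uniformly random new element of \<open>R\<close> has
joined \<open>D\<close>. Its iterates \<open>mean_up R ^^ s\<close> average over \<open>s\<close> steps, so no distribution on the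
levels has to be introduced.\<close>

definition mean_up :: "'a set \<Rightarrow> ('a set \<Rightarrow> real) \<Rightarrow> 'a set \<Rightarrow> real" where
  "mean_up R g D = (\<Sum>b\<in>R - D. g (insert b D)) / real (card (R - D))"

lemma mass_nonneg: "0 \<le> mass V F"
  unfolding mass_def by (intro sum_nonneg) simp

lemma mass_mono: "finite G \<Longrightarrow> F \<subseteq> G \<Longrightarrow> mass V F \<le> mass V G"
  unfolding mass_def by (intro sum_mono2) auto

lemma mass_Un_le: "finite F \<Longrightarrow> finite G \<Longrightarrow> mass V (F \<union> G) \<le> mass V F + mass V G"
  unfolding mass_def by (subst sum.union_inter[symmetric]) (auto intro!: sum_nonneg)

lemma finite_family: "finite V \<Longrightarrow> F \<subseteq> Pow V \<Longrightarrow> finite F"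
  by (meson finite_Pow_iff finite_subset)

lemma link_empty [simp]: "link F {} {} = F"
  by (auto simp: link_def)

lemma link_subset_Pow: "F \<subseteq> Pow V \<Longrightarrow> link F Y X \<subseteq> Pow (V - (Y \<union> X))"
  by (auto simp: link_def)

lemma link_link: "Y \<inter> (A \<union> B) = {} \<Longrightarrow> link (link F A B) Y X = link F (A \<union> Y) (B \<union> X)"
  by (auto simp: link_def Un_assoc)

lemma sum_over_incidences:
  fixes g :: "'b \<Rightarrow> real"
  assumes "finite V" "finite F"
  shows "(\<Sum>b\<in>V. \<Sum>A | A \<in> F \<and> P b A. g A) = (\<Sum>A\<in>F. real (card {b\<in>V. P b A}) * g A)"
  by (subst sum.swap_restrict[OF assms]) simp

text \<open>Conditioning on the first element of a random maximal chain. On a single set \<open>A\<close> of size \<open>k \<ge> 1\<close> this is the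
identity \<open>k / ((n - 1) choose (k - 1)) = n / (n choose k)\<close>.\<close>

lemma mass_by_first_element:
  assumes V: "finite V" and F: "F \<subseteq> Pow V"
  shows "mass V F = of_bool ({} \<in> F) + (\<Sum>b\<in>V. mass (V - {b}) (link F {b} {})) / real (card V)"
proof -
  let ?n = "card V"
  have finF: "finite F" using finite_family[OF V F] .
  have link_mass: "mass (V - {b}) (link F {b} {}) = (\<Sum>A | A \<in> F \<and> b \<in> A. 1 / real (?n - 1 choose (card A - 1)))"
    if b: "b \<in> V" for b
  proof -
    have inj: "inj_on (\<lambda>A. A - {b}) {A. A \<in> F \<and> b \<in> A}" by (rule inj_onI) blast
    have im: "link F {b} {} = (\<lambda>A. A - {b}) ` {A. A \<in> F \<and> b \<in> A}"
    proof
      show "link F {b} {} \<subseteq> (\<lambda>A. A - {b}) ` {A. A \<in> F \<and> b \<in> A}"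
      proof
        fix D assume "D \<in> link F {b} {}"
        then have "insert b D \<in> F" "D = insert b D - {b}" by (auto simp: link_def)
        then show "D \<in> (\<lambda>A. A - {b}) ` {A. A \<in> F \<and> b \<in> A}" by blast
      qed
      show "(\<lambda>A. A - {b}) ` {A. A \<in> F \<and> b \<in> A} \<subseteq> link F {b} {}"
        by (auto simp: link_def insert_absorb)
    qed
    have "mass (V - {b}) (link F {b} {}) = (\<Sum>A | A \<in> F \<and> b \<in> A. 1 / real (card (V - {b}) choose card (A - {b})))"
      unfolding mass_def im by (subst sum.reindex[OF inj]) simp
    also have "\<dots> = (\<Sum>A | A \<in> F \<and> b \<in> A. 1 / real (?n - 1 choose (card A - 1)))"
      by (rule sum.cong) (use b V F in \<open>auto simp: card_Diff_singleton\<close>)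
    finally show ?thesis .
  qed
  have "(\<Sum>b\<in>V. mass (V - {b}) (link F {b} {}))
      = (\<Sum>A\<in>F. real (card {b\<in>V. b \<in> A}) * (1 / real (?n - 1 choose (card A - 1))))"
    using link_mass by (simp add: sum_over_incidences[OF V finF])
  also have "\<dots> = (\<Sum>A\<in>F. real ?n * (if A = {} then 0 else 1 / real (?n choose card A)))"
  proof (rule sum.cong[OF refl])
    fix A assume A: "A \<in> F"
    then have sub: "A \<subseteq> V" using F by auto
    then have finA: "finite A" using V finite_subset by blast
    have inter: "{b\<in>V. b \<in> A} = A" using sub by auto
    have le: "card A \<le> ?n" using sub V by (simp add: card_mono)
    show "real (card {b\<in>V. b \<in> A}) * (1 / real (?n - 1 choose (card A - 1)))
        = real ?n * (if A = {} then 0 else 1 / real (?n choose card A))"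
    proof (cases "A = {}")
      case True
      then show ?thesis by simp
    next
      case False
      then have k: "0 < card A" using finA by (simp add: card_gt_0_iff)
      have "card A - 1 \<le> ?n - 1" using le by simp
      then have pos: "?n - 1 choose (card A - 1) > 0" "?n choose card A > 0" using le by simp_all
      have "real (card A) * real (?n choose card A) = real ?n * real (?n - 1 choose (card A - 1))"
        using times_binomial_minus1_eq[OF k, of ?n] by (metis of_nat_mult)
      then show ?thesis using False pos inter by (simp add: field_simps)
    qed
  qed
  finally have eq: "(\<Sum>b\<in>V. mass (V - {b}) (link F {b} {}))
      = real ?n * (\<Sum>A\<in>F. if A = {} then 0 else 1 / real (?n choose card A))"
    by (simp add: sum_distrib_left)
  have "mass V F = (\<Sum>A\<in>F. of_bool (A = {}) + (if A = {} then 0 else 1 / real (?n choose card A)))"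
    unfolding mass_def by (rule sum.cong) auto
  also have "\<dots> = of_bool ({} \<in> F) + (\<Sum>A\<in>F. if A = {} then 0 else 1 / real (?n choose card A))"
    using finF by (simp add: sum.distrib of_bool_def)
  also have "(\<Sum>A\<in>F. if A = {} then 0 else 1 / real (?n choose card A))
      = (\<Sum>b\<in>V. mass (V - {b}) (link F {b} {})) / real ?n"
  proof (cases "V = {}")
    case True
    then show ?thesis using F by (auto intro!: sum.neutral)
  next
    case False
    then show ?thesis unfolding eq using V by simp
  qed
  finally show ?thesis .
qed

text \<open>The dual of \<open>mass_by_first_element\<close>: conditioning on the last element of a random maximal chain. The
full set is excluded because it lies in no subcube that omits an element.\<close>

lemma mass_by_first_omitted_element:
  assumes V: "finite V" and F: "F \<subseteq> Pow V" and small: "\<And>A. A \<in> F \<Longrightarrow> card A < card V"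
  shows "mass V F = (\<Sum>b\<in>V. mass (V - {b}) (link F {} {b})) / real (card V)"
proof (cases "V = {}")
  case True
  then show ?thesis using small F by (auto simp: mass_def intro!: sum.neutral)
next
  case False
  let ?n = "card V"
  have finF: "finite F" using finite_family[OF V F] .
  have n: "?n > 0" using False V by (simp add: card_gt_0_iff)
  have link_mass: "mass (V - {b}) (link F {} {b}) = (\<Sum>A | A \<in> F \<and> b \<notin> A. 1 / real (?n - 1 choose card A))"
    if b: "b \<in> V" for b
  proof -
    have "link F {} {b} = {A. A \<in> F \<and> b \<notin> A}" by (auto simp: link_def)
    then show ?thesis unfolding mass_def using b V by simp
  qed
  have "(\<Sum>b\<in>V. mass (V - {b}) (link F {} {b}))
      = (\<Sum>A\<in>F. real (card {b\<in>V. b \<notin> A}) * (1 / real (?n - 1 choose card A)))"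
    using link_mass by (simp add: sum_over_incidences[OF V finF])
  also have "\<dots> = (\<Sum>A\<in>F. real ?n * (1 / real (?n choose card A)))"
  proof (rule sum.cong[OF refl])
    fix A assume A: "A \<in> F"
    then have sub: "A \<subseteq> V" using F by auto
    have "{b\<in>V. b \<notin> A} = V - A" by auto
    then have c: "card {b\<in>V. b \<notin> A} = ?n - card A" using sub V by (simp add: card_Diff_subset finite_subset)
    have le: "card A \<le> ?n - 1" using small[OF A] by simp
    then have pos: "?n - 1 choose card A > 0" "?n choose card A > 0" by simp_all
    have "real (?n - card A) * real (?n choose card A) = real ?n * real (?n - 1 choose card A)"
      using binomial_absorb_comp[of ?n "card A"] by (metis of_nat_mult)
    then show "real (card {b\<in>V. b \<notin> A}) * (1 / real (?n - 1 choose card A))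
        = real ?n * (1 / real (?n choose card A))"
      unfolding c using pos by (simp add: field_simps)
  qed
  also have "\<dots> = real ?n * mass V F" unfolding mass_def by (simp add: sum_distrib_left)
  finally show ?thesis using n by simp
qed

text \<open>As long as \<open>D\<close> is too small to be a member of \<open>G\<close>, the first summand vanishes, and the mass above \<open>D\<close>
is a martingale along the random chain.\<close>

lemma mass_above_split:
  assumes R: "finite R" and G: "G \<subseteq> Pow R" and D: "D \<subseteq> R"
  shows "mass (R - D) (link G D {})
       = of_bool (D \<in> G) + mean_up R (\<lambda>D. mass (R - D) (link G D {})) D"
proof -
  have sub: "link G D {} \<subseteq> Pow (R - D)" using link_subset_Pow[OF G, of D "{}"] by simp
  have "mass (R - insert b D) (link G (insert b D) {}) = mass (R - D - {b}) (link (link G D {}) {b} {})"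
    if "b \<in> R - D" for b
  proof -
    have "R - insert b D = R - D - {b}" by auto
    moreover have "link (link G D {}) {b} {} = link G (insert b D) {}"
      using that by (subst link_link) auto
    ultimately show ?thesis by simp
  qed
  then have "mean_up R (\<lambda>D. mass (R - D) (link G D {})) D
      = (\<Sum>b\<in>R - D. mass (R - D - {b}) (link (link G D {}) {b} {})) / real (card (R - D))"
    unfolding mean_up_def by simp
  moreover have "{} \<in> link G D {} \<longleftrightarrow> D \<in> G" by (simp add: link_def)
  ultimately show ?thesis using mass_by_first_element[OF _ sub] R by simp
qed

lemma mass_avoiding_split:
  assumes R: "finite R" and G: "G \<subseteq> Pow R" and D: "D \<subseteq> R"
    and small: "\<And>A. A \<in> G \<Longrightarrow> card A + card D < card R"
  shows "mass (R - D) (link G {} D) = mean_up R (\<lambda>D. mass (R - D) (link G {} D)) D"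
proof -
  have sub: "link G {} D \<subseteq> Pow (R - D)" using link_subset_Pow[OF G, of "{}" D] by simp
  have "mass (R - insert b D) (link G {} (insert b D)) = mass (R - D - {b}) (link (link G {} D) {} {b})"
    for b
  proof -
    have "R - insert b D = R - D - {b}" by auto
    moreover have "link (link G {} D) {} {b} = link G {} (insert b D)"
      by (subst link_link) auto
    ultimately show ?thesis by simp
  qed
  then have "mean_up R (\<lambda>D. mass (R - D) (link G {} D)) D
      = (\<Sum>b\<in>R - D. mass (R - D - {b}) (link (link G {} D) {} {b})) / real (card (R - D))"
    unfolding mean_up_def by simp
  moreover have "card A < card (R - D)" if "A \<in> link G {} D" for A
  proof -
    have "A \<in> G" using that by (simp add: link_def)
    then show ?thesis using small[of A] D R by (simp add: card_Diff_subset finite_subset)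
  qed
  ultimately show ?thesis using mass_by_first_omitted_element[OF _ sub] R by simp
qed

section \<open>Martingales on random chains\<close>

text \<open>In other words, \<open>M\<close> is a martingale along the random chain up to level \<open>z\<close>.\<close>

definition harmonic_below :: "'a set \<Rightarrow> nat \<Rightarrow> ('a set \<Rightarrow> real) \<Rightarrow> bool" where
  "harmonic_below R z M \<longleftrightarrow> (\<forall>D\<subseteq>R. card D < z \<longrightarrow> M D = mean_up R M D)"

lemma mean_up_mono:
  assumes "\<And>b. b \<in> R - D \<Longrightarrow> g (insert b D) \<le> h (insert b D)"
  shows "mean_up R g D \<le> mean_up R h D"
  unfolding mean_up_def by (intro divide_right_mono sum_mono assms) auto

lemma mean_up_pow_mono:
  assumes "finite R" "D \<subseteq> R"
    and "\<And>E. E \<subseteq> R \<Longrightarrow> card E = card D + s \<Longrightarrow> g E \<le> h E"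
  shows "(mean_up R ^^ s) g D \<le> (mean_up R ^^ s) h D"
  using assms(2,3)
proof (induction s arbitrary: D)
  case 0
  then show ?case by simp
next
  case (Suc s)
  have "(mean_up R ^^ s) g (insert b D) \<le> (mean_up R ^^ s) h (insert b D)" if "b \<in> R - D" for b
  proof (rule Suc.IH)
    have "card (insert b D) = Suc (card D)"
      using that Suc.prems(1) assms(1) by (simp add: finite_subset)
    then show "g E \<le> h E" if "E \<subseteq> R" "card E = card (insert b D) + s" for E
      using Suc.prems(2)[of E] that by simp
  qed (use that Suc.prems(1) in auto)
  then show ?case unfolding funpow.simps comp_def by (intro mean_up_mono)
qed

lemma mean_up_linear: "mean_up R (\<lambda>D. a * g D + b * h D) = (\<lambda>D. a * mean_up R g D + b * mean_up R h D)"
  unfolding mean_up_def by (auto simp: sum.distrib sum_distrib_left add_divide_distrib)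

lemma mean_up_pow_linear:
  "(mean_up R ^^ s) (\<lambda>D. a * g D + b * h D) = (\<lambda>D. a * (mean_up R ^^ s) g D + b * (mean_up R ^^ s) h D)"
  by (induction s) (simp_all add: mean_up_linear)

lemma mean_up_pow_sum:
  "finite J \<Longrightarrow> (mean_up R ^^ s) (\<lambda>D. \<Sum>j\<in>J. g j D) = (\<lambda>D. \<Sum>j\<in>J. (mean_up R ^^ s) (g j) D)"
proof (induction s)
  case (Suc s)
  then show ?case unfolding mean_up_def
    by (auto simp: sum_divide_distrib intro: sum.swap)
qed simp

lemma harmonic_sum:
  assumes "finite R" "harmonic_below R z M" "D \<subseteq> R" "card D < z" "z \<le> card R"
  shows "card (R - D) > 0" "(\<Sum>b\<in>R - D. M (insert b D)) = real (card (R - D)) * M D"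
proof -
  have "card (R - D) = card R - card D" using assms by (simp add: card_Diff_subset finite_subset)
  then show pos: "card (R - D) > 0" using assms by simp
  have "M D = mean_up R M D" using assms unfolding harmonic_below_def by blast
  then show "(\<Sum>b\<in>R - D. M (insert b D)) = real (card (R - D)) * M D"
    using pos unfolding mean_up_def by (simp add: field_simps)
qed

lemma sum_square_shift:
  fixes f :: "'b \<Rightarrow> real"
  shows "(\<Sum>x\<in>A. (f x - c)\<^sup>2) = (\<Sum>x\<in>A. (f x)\<^sup>2) - 2 * c * (\<Sum>x\<in>A. f x) + real (card A) * c\<^sup>2"
  by (simp add: power2_diff sum.distrib sum_subtractf sum_distrib_left sum_distrib_right mult_ac)

text \<open>Jensen's inequality for one step of the martingale.\<close>

lemma harmonic_square_le_mean_up: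
  assumes "finite R" "harmonic_below R z M" "D \<subseteq> R" "card D < z" "z \<le> card R"
  shows "(M D - c)\<^sup>2 \<le> mean_up R (\<lambda>D. (M D - c)\<^sup>2) D"
proof -
  note h = harmonic_sum[OF assms]
  let ?N = "real (card (R - D))" and ?u = "\<lambda>b. M (insert b D) - c"
  have "(\<Sum>b\<in>R - D. ?u b) = ?N * (M D - c)" using h by (simp add: sum_subtractf algebra_simps)
  then have "2 * (M D - c) * (\<Sum>b\<in>R - D. ?u b) = 2 * (?N * (M D - c)\<^sup>2)"
    by (simp only: power2_eq_square mult_ac)
  moreover have "0 \<le> (\<Sum>b\<in>R - D. (?u b - (M D - c))\<^sup>2)" by (intro sum_nonneg) simp
  moreover have "(\<Sum>b\<in>R - D. (?u b - (M D - c))\<^sup>2)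
      = (\<Sum>b\<in>R - D. (?u b)\<^sup>2) - 2 * (M D - c) * (\<Sum>b\<in>R - D. ?u b) + ?N * (M D - c)\<^sup>2"
    by (rule sum_square_shift)
  ultimately have "?N * (M D - c)\<^sup>2 \<le> (\<Sum>b\<in>R - D. (?u b)\<^sup>2)" by linarith
  then show ?thesis unfolding mean_up_def using h(1) by (simp add: field_simps)
qed

text \<open>Here \<open>m\<close>, \<open>w a\<close> and \<open>v a b\<close> are the values of a martingale at a set, after adding \<open>a\<close>, and after adding
\<open>a\<close> and \<open>b\<close>. Because the order of the two additions does not matter, the second increment
\<open>v a b - w a\<close> has the same mean square as \<open>v a b - w b\<close>. For fixed \<open>a\<close> the sum of the latter
over \<open>b\<close> is \<open>N (w a - m)\<close> with \<open>N = card A\<close>, so the second increment is at least as large in mean square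
as the first increment \<open>w a - m\<close>.\<close>

lemma two_step_square_inequality:
  fixes v :: "'a \<Rightarrow> 'a \<Rightarrow> real" and w :: "'a \<Rightarrow> real"
  assumes A: "finite A" "A \<noteq> {}" and sym: "\<And>a b. v a b = v b a"
    and w: "(\<Sum>a\<in>A. w a) = real (card A) * m"
    and v: "\<And>a. a \<in> A \<Longrightarrow> (\<Sum>b\<in>A - {a}. v a b) = (real (card A) - 1) * w a"
  shows "(real (card A) - 1) * (2 * (\<Sum>a\<in>A. (w a)\<^sup>2) - real (card A) * m\<^sup>2)
       \<le> (\<Sum>a\<in>A. \<Sum>b\<in>A - {a}. (v a b)\<^sup>2)"
proof -
  define N where "N = real (card A)"
  have N: "N \<ge> 1" using A unfolding N_def by (simp add: Suc_leI card_gt_0_iff)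
  have cardm: "real (card (A - {a})) = N - 1" if "a \<in> A" for a
    using that A N unfolding N_def by (simp add: card_Diff_singleton of_nat_diff)
  have swap: "(\<Sum>a\<in>A. \<Sum>b\<in>A - {a}. f a b) = (\<Sum>b\<in>A. \<Sum>a\<in>A - {b}. f a b)" for f :: "'a \<Rightarrow> 'a \<Rightarrow> real"
  proof -
    have "(\<Sum>a\<in>A. \<Sum>b\<in>A - {a}. f a b) = (\<Sum>a\<in>A. \<Sum>b | b \<in> A \<and> a \<noteq> b. f a b)"
      by (intro sum.cong) auto
    also have "\<dots> = (\<Sum>b\<in>A. \<Sum>a | a \<in> A \<and> a \<noteq> b. f a b)" by (rule sum.swap_restrict[OF A(1) A(1)])
    also have "\<dots> = (\<Sum>b\<in>A. \<Sum>a\<in>A - {b}. f a b)" by (intro sum.cong) auto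
    finally show ?thesis .
  qed
  have "(N - 1) * (w a - m)\<^sup>2 \<le> (\<Sum>b\<in>A - {a}. (v a b - w b)\<^sup>2)" if a: "a \<in> A" for a
  proof -
    let ?u = "w a - m"
    have "(\<Sum>b\<in>A - {a}. w b) = N * m - w a" using a A w unfolding N_def by (simp add: sum_diff1)
    then have d: "(\<Sum>b\<in>A - {a}. v a b - w b) = N * ?u"
      using v[OF a] unfolding N_def by (simp add: sum_subtractf algebra_simps)
    \<comment> \<open>The \<open>N - 1\<close> differences add up to \<open>N * ?u\<close>; comparing each with \<open>?u\<close> bounds the sum of their squares from below by \<open>(N + 1) * ?u\<^sup>2\<close>.\<close>
    have "0 \<le> (\<Sum>b\<in>A - {a}. (v a b - w b - ?u)\<^sup>2)" by (intro sum_nonneg) simp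
    also have "\<dots> = (\<Sum>b\<in>A - {a}. (v a b - w b)\<^sup>2) - 2 * ?u * (\<Sum>b\<in>A - {a}. v a b - w b) + (N - 1) * ?u\<^sup>2"
      using sum_square_shift[of "\<lambda>b. v a b - w b" ?u "A - {a}"] unfolding cardm[OF a] .
    finally have "(N + 1) * ?u\<^sup>2 \<le> (\<Sum>b\<in>A - {a}. (v a b - w b)\<^sup>2)"
      unfolding d by (simp add: power2_eq_square algebra_simps)
    moreover have "(N - 1) * ?u\<^sup>2 \<le> (N + 1) * ?u\<^sup>2" by (intro mult_right_mono) auto
    ultimately show ?thesis by simp
  qed
  then have "(\<Sum>a\<in>A. (N - 1) * (w a - m)\<^sup>2) \<le> (\<Sum>a\<in>A. \<Sum>b\<in>A - {a}. (v a b - w b)\<^sup>2)" by (rule sum_mono)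
  also have "\<dots> = (\<Sum>a\<in>A. \<Sum>b\<in>A - {a}. (v a b)\<^sup>2) - 2 * (\<Sum>a\<in>A. \<Sum>b\<in>A - {a}. v a b * w b)
      + (\<Sum>a\<in>A. \<Sum>b\<in>A - {a}. (w b)\<^sup>2)"
    unfolding power2_diff by (simp add: sum.distrib sum_subtractf sum_distrib_left mult_ac)
  also have "(\<Sum>a\<in>A. \<Sum>b\<in>A - {a}. v a b * w b) = (\<Sum>b\<in>A. \<Sum>a\<in>A - {b}. v b a * w b)"
    using swap[of "\<lambda>a b. v a b * w b"] sym by simp
  also have "\<dots> = (\<Sum>b\<in>A. (N - 1) * (w b)\<^sup>2)"
    by (rule sum.cong) (use v in \<open>auto simp: sum_distrib_right[symmetric] N_def power2_eq_square\<close>)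
  also have "(\<Sum>a\<in>A. \<Sum>b\<in>A - {a}. (w b)\<^sup>2) = (\<Sum>b\<in>A. (N - 1) * (w b)\<^sup>2)"
    unfolding swap[of "\<lambda>a b. (w b)\<^sup>2"] by (rule sum.cong) (use cardm in auto)
  finally have "(N - 1) * (\<Sum>a\<in>A. (w a - m)\<^sup>2) + (N - 1) * (\<Sum>a\<in>A. (w a)\<^sup>2)
      \<le> (\<Sum>a\<in>A. \<Sum>b\<in>A - {a}. (v a b)\<^sup>2)"
    unfolding sum_distrib_left[symmetric] by linarith
  moreover have "(\<Sum>a\<in>A. (w a - m)\<^sup>2) = (\<Sum>a\<in>A. (w a)\<^sup>2) - N * m\<^sup>2"
  proof -
    have "(\<Sum>a\<in>A. (w a - m)\<^sup>2) = (\<Sum>a\<in>A. (w a)\<^sup>2) - 2 * m * (\<Sum>a\<in>A. w a) + N * m\<^sup>2"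
      unfolding N_def by (rule sum_square_shift)
    then show ?thesis unfolding w N_def by (simp add: power2_eq_square)
  qed
  ultimately show ?thesis unfolding N_def[symmetric] by (simp add: algebra_simps)
qed

text \<open>The mean square of a martingale on random sets is a convex function of the level: its increments
are the mean squares of the steps, which grow by \<open>two_step_square_inequality\<close>.\<close>

lemma harmonic_square_convex:
  assumes R: "finite R" and M: "harmonic_below R z M" and D: "D \<subseteq> R" "card D + 2 \<le> z" and z: "z \<le> card R"
  defines "q \<equiv> (\<lambda>D. (M D)\<^sup>2)"
  shows "2 * mean_up R q D \<le> mean_up R (mean_up R q) D + q D"
proof -
  define A where "A = R - D"
  define N where "N = real (card A)"
  have finD: "finite D" using D R finite_subset by blast
  have cA: "card A = card R - card D" unfolding A_def using D R by (simp add: card_Diff_subset finite_subset)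
  have N: "N \<ge> 2" using cA D(2) z unfolding N_def by simp
  have finA: "finite A" unfolding A_def using R by simp
  have cardm: "real (card (A - {a})) = N - 1" if "a \<in> A" for a
    using that finA N unfolding N_def by (simp add: card_Diff_singleton of_nat_diff)
  have diff: "R - insert a D = A - {a}" for a unfolding A_def by auto
  define v where "v a b = M (insert b (insert a D))" for a b
  define w where "w a = M (insert a D)" for a
  have w: "(\<Sum>a\<in>A. w a) = real (card A) * M D"
    using harmonic_sum(2)[OF R M D(1) _ z] D(2) unfolding A_def w_def by simp
  have v: "(\<Sum>b\<in>A - {a}. v a b) = (real (card A) - 1) * w a" if a: "a \<in> A" for a
  proof -
    have "card (insert a D) = Suc (card D)" "insert a D \<subseteq> R" using a D finD unfolding A_def by auto
    then show ?thesis using harmonic_sum(2)[OF R M _ _ z, of "insert a D"] D(2) cardm[OF a]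
      unfolding diff v_def w_def N_def by simp
  qed
  have Ane: "A \<noteq> {}" using N unfolding N_def by auto
  have "v a b = v b a" for a b unfolding v_def by (simp add: insert_commute)
  from two_step_square_inequality[OF finA Ane this w v]
  have main: "(N - 1) * (2 * (\<Sum>a\<in>A. (w a)\<^sup>2) - N * (M D)\<^sup>2) \<le> (\<Sum>a\<in>A. \<Sum>b\<in>A - {a}. (v a b)\<^sup>2)"
    unfolding N_def by simp
  have "mean_up R q D = (\<Sum>a\<in>A. (w a)\<^sup>2) / N" unfolding mean_up_def q_def A_def[symmetric] N_def w_def by simp
  moreover have "mean_up R (mean_up R q) D = (\<Sum>a\<in>A. \<Sum>b\<in>A - {a}. (v a b)\<^sup>2) / ((N - 1) * N)"
  proof -
    have "mean_up R q (insert a D) = (\<Sum>b\<in>A - {a}. (v a b)\<^sup>2) / (N - 1)" if "a \<in> A" for a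
      unfolding mean_up_def diff q_def v_def using cardm[OF that] by simp
    then have "mean_up R (mean_up R q) D = (\<Sum>a\<in>A. (\<Sum>b\<in>A - {a}. (v a b)\<^sup>2) / (N - 1)) / N"
      unfolding mean_up_def[of R "mean_up R q"] A_def[symmetric] N_def by simp
    then show ?thesis by (simp add: sum_divide_distrib[symmetric])
  qed
  moreover have "2 * ((\<Sum>a\<in>A. (w a)\<^sup>2) / N) - (M D)\<^sup>2
      = (N - 1) * (2 * (\<Sum>a\<in>A. (w a)\<^sup>2) - N * (M D)\<^sup>2) / ((N - 1) * N)"
    using N by (simp add: field_simps)
  moreover have "\<dots> \<le> (\<Sum>a\<in>A. \<Sum>b\<in>A - {a}. (v a b)\<^sup>2) / ((N - 1) * N)"
    using main N by (intro divide_right_mono) auto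
  moreover have "q D = (M D)\<^sup>2" by (simp add: q_def)
  ultimately show ?thesis by linarith
qed

text \<open>A convex sequence starting at \<open>0\<close> lies below its chords through the origin.\<close>

lemma convex_sequence_chord:
  fixes Q :: "nat \<Rightarrow> real"
  assumes conv: "\<And>s. s + 2 \<le> z \<Longrightarrow> 2 * Q (s + 1) \<le> Q (s + 2) + Q s" and Q0: "Q 0 = 0" and "s \<le> z"
  shows "real z * Q s \<le> real s * Q z"
proof -
  have inc: "real (s + 1) * Q s \<le> real s * Q (s + 1)" if "s < z" for s
    using that
  proof (induction s)
    case 0
    then show ?case using Q0 by simp
  next
    case (Suc s)
    have "real (s + 1) * (2 * Q (s + 1)) \<le> real (s + 1) * (Q (s + 2) + Q s)"
      using conv[of s] Suc.prems by (intro mult_left_mono) auto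
    then show ?case using Suc by (simp add: algebra_simps)
  qed
  have "real (s + k) * Q s \<le> real s * Q (s + k)" if "s + k \<le> z" for k
    using that
  proof (induction k)
    case 0
    then show ?case by simp
  next
    case (Suc k)
    show ?case
    proof (cases "s + k = 0")
      case True
      then show ?thesis using Q0 by simp
    next
      case False
      have "real (s + k) * (real (s + k + 1) * Q s) \<le> real (s + k + 1) * (real s * Q (s + k))"
        using Suc by (simp add: mult_left_mono mult.left_commute)
      also have "\<dots> = real s * (real (s + k + 1) * Q (s + k))" by simp
      also have "\<dots> \<le> real s * (real (s + k) * Q (s + k + 1))"
        using inc[of "s + k"] Suc.prems by (intro mult_left_mono) auto
      also have "\<dots> = real (s + k) * (real s * Q (s + k + 1))" by simp
      finally show ?thesis using False by (simp add: mult_le_cancel_left_pos)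
    qed
  qed
  from this[of "z - s"] show ?thesis using assms(3) by simp
qed

text \<open>The variance is convex in the level and at most \<open>K\<^sup>2\<close> at level \<open>z\<close>, so at level \<open>L\<close> only the fraction
\<open>L / z\<close> of that has been reached. This quantifies that a martingale determined at high levels hardly
depends on the first elements of the chain.\<close>

lemma harmonic_variance_decay:
  assumes R: "finite R" and M: "harmonic_below R z M" and z: "z \<le> card R" and L: "L \<le> z"
    and bound: "\<And>D. D \<subseteq> R \<Longrightarrow> \<bar>M D - M {}\<bar> \<le> K"
  shows "real z * (mean_up R ^^ L) (\<lambda>D. (M D - M {})\<^sup>2) {} \<le> real L * K\<^sup>2"
proof -
  define q where "q = (\<lambda>D. (M D - M {})\<^sup>2)"
  define Q where "Q s = (mean_up R ^^ s) q {}" for s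
  have M': "harmonic_below R z (\<lambda>D. M D - M {})"
    unfolding harmonic_below_def
  proof (intro allI impI)
    fix D assume D: "D \<subseteq> R" "card D < z"
    note h = harmonic_sum[OF R M D z]
    show "M D - M {} = mean_up R (\<lambda>D. M D - M {}) D"
      unfolding mean_up_def using h by (simp add: sum_subtractf field_simps)
  qed
  \<comment> \<open>Convexity holds at every set, so it survives averaging over the first \<open>s\<close> steps.\<close>
  have conv: "2 * Q (s + 1) \<le> Q (s + 2) + Q s" if "s + 2 \<le> z" for s
  proof -
    have "(mean_up R ^^ s) (\<lambda>D. 2 * mean_up R q D + 0 * q D) {}
        \<le> (mean_up R ^^ s) (\<lambda>D. 1 * mean_up R (mean_up R q) D + 1 * q D) {}"
    proof (rule mean_up_pow_mono[OF R])
      fix E assume "E \<subseteq> R" "card E = card {} + s"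
      then show "2 * mean_up R q E + 0 * q E \<le> 1 * mean_up R (mean_up R q) E + 1 * q E"
        using harmonic_square_convex[OF R M' _ _ z, of E] that unfolding q_def by simp
    qed simp
    then show ?thesis unfolding mean_up_pow_linear Q_def
      by (simp add: funpow_swap1 numeral_2_eq_2)
  qed
  have "Q 0 = 0" unfolding Q_def q_def by simp
  from convex_sequence_chord[of z Q, OF conv this L] have "real z * Q L \<le> real L * Q z" by simp
  moreover have "Q z \<le> K\<^sup>2"
  proof -
    have "(mean_up R ^^ s) (\<lambda>_. c) D \<le> c" if "c \<ge> 0" for s c D
    proof (induction s arbitrary: D)
      case (Suc s)
      have "(mean_up R ^^ Suc s) (\<lambda>_. c) D \<le> mean_up R (\<lambda>_. c) D"
        by (simp add: mean_up_mono Suc)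
      also have "\<dots> \<le> c" unfolding mean_up_def using that by simp
      finally show ?case .
    qed simp
    moreover have "Q z \<le> (mean_up R ^^ z) (\<lambda>_. K\<^sup>2) {}"
      unfolding Q_def
    proof (rule mean_up_pow_mono[OF R])
      fix E assume "E \<subseteq> R"
      then show "q E \<le> K\<^sup>2" using bound[of E] unfolding q_def by (metis abs_ge_zero power2_abs power_mono)
    qed simp
    ultimately show ?thesis by (meson order_trans zero_le_power2)
  qed
  ultimately show ?thesis unfolding Q_def q_def
    by (meson mult_left_mono of_nat_0_le_iff order_trans)
qed

text \<open>A maximal inequality. Stop the random chain when it first meets \<open>H\<close>. From there on at most \<open>K\<close>
members, the current one included, are expected, while the submartingale \<open>g\<close> is already at least \<open>\<epsilon>\<close>;
so the total mass is at most \<open>K / \<epsilon>\<close> times the expectation of \<open>g\<close> at level \<open>L\<close>. The induction goes down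
from level \<open>L\<close> and proves this from every starting set \<open>D\<close>.\<close>

lemma mass_le_submartingale:
  assumes R: "finite R" and H: "H \<subseteq> Pow R" "\<And>A. A \<in> H \<Longrightarrow> card A \<le> L" and L: "L \<le> card R"
    and bound: "\<And>D. D \<subseteq> R \<Longrightarrow> mass (R - D) (link H D {}) \<le> K"
    and nonneg: "\<And>D. 0 \<le> g D" and sub: "\<And>D. D \<subseteq> R \<Longrightarrow> card D < L \<Longrightarrow> g D \<le> mean_up R g D"
    and eps: "\<epsilon> > 0" "\<And>D. D \<in> H \<Longrightarrow> \<epsilon> \<le> g D"
  shows "mass R H \<le> K / \<epsilon> * (mean_up R ^^ L) g {}"
proof -
  have K: "K \<ge> 0" using bound[of "{}"] mass_nonneg[of R H] by simp
  have grow: "g D \<le> (mean_up R ^^ s) g D" if "D \<subseteq> R" "card D + s \<le> L" for D s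
    using that
  proof (induction s)
    case (Suc s)
    have "(mean_up R ^^ s) g D \<le> (mean_up R ^^ s) (mean_up R g) D"
      by (rule mean_up_pow_mono[OF R Suc.prems(1)]) (use sub Suc.prems in auto)
    then show ?case using Suc by (simp add: funpow_swap1)
  qed simp
  have "mass (R - D) (link H D {}) \<le> K / \<epsilon> * (mean_up R ^^ s) g D" if "D \<subseteq> R" "card D + s = L" for D s
    using that
  proof (induction s arbitrary: D)
    case 0
    show ?case
    proof (cases "D \<in> H")
      case True
      have "K * 1 \<le> K * (g D / \<epsilon>)" using eps(2)[OF True] eps(1) K by (intro mult_left_mono) auto
      then show ?thesis using bound[OF 0(1)] by simp
    next
      case False
      have "link H D {} = {}"
      proof (rule ccontr)
        assume "link H D {} \<noteq> {}"
        then obtain E where E: "E \<inter> D = {}" "D \<union> E \<in> H" by (auto simp: link_def)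
        have "D \<union> E \<subseteq> R" using H(1) E(2) by auto
        then have fin: "finite D" "finite E" using finite_subset[OF _ R] by auto
        have "card D + card E \<le> L" using H(2)[OF E(2)] E(1) fin by (simp add: card_Un_disjoint Int_commute)
        then have "E = {}" using 0(2) fin by simp
        then show False using E False by simp
      qed
      then show ?thesis using nonneg[of D] K eps by (simp add: mass_def)
    qed
  next
    case (Suc s)
    show ?case
    proof (cases "D \<in> H")
      case True
      have "K * 1 \<le> K * (g D / \<epsilon>)" using eps(2)[OF True] eps(1) K by (intro mult_left_mono) auto
      then have "mass (R - D) (link H D {}) \<le> K / \<epsilon> * g D" using bound[OF Suc.prems(1)] by simp
      also have "\<dots> \<le> K / \<epsilon> * (mean_up R ^^ Suc s) g D"
        using grow[of D "Suc s"] Suc.prems K eps(1) by (intro mult_left_mono) auto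
      finally show ?thesis .
    next
      case False
      have "mass (R - D) (link H D {}) = mean_up R (\<lambda>D. mass (R - D) (link H D {})) D"
        using mass_above_split[OF R H(1) Suc.prems(1)] False by simp
      also have "\<dots> \<le> mean_up R (\<lambda>D. K / \<epsilon> * (mean_up R ^^ s) g D + 0 * g D) D"
      proof (rule mean_up_mono)
        fix b assume b: "b \<in> R - D"
        have "finite D" using Suc.prems(1) R finite_subset by blast
        then have "card (insert b D) + s = L" using b Suc.prems by simp
        then show "mass (R - insert b D) (link H (insert b D) {})
            \<le> K / \<epsilon> * (mean_up R ^^ s) g (insert b D) + 0 * g (insert b D)"
          using Suc.IH[of "insert b D"] b Suc.prems(1) by simp
      qed
      also have "\<dots> = K / \<epsilon> * (mean_up R ^^ Suc s) g D" unfolding mean_up_linear by simp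
      finally show ?thesis .
    qed
  qed
  from this[of "{}" L] show ?thesis by simp
qed

section \<open>Embedding an order into separated blocks of levels\<close>

definition mass_bounded_on_subcubes :: "'a set \<Rightarrow> 'a set set \<Rightarrow> real \<Rightarrow> bool" where
  "mass_bounded_on_subcubes R G K \<longleftrightarrow>
     (\<forall>Y X. Y \<subseteq> R \<longrightarrow> X \<subseteq> R \<longrightarrow> Y \<inter> X = {} \<longrightarrow> mass (R - (Y \<union> X)) (link G Y X) \<le> K)"

text \<open>What remains of a later block once the increment \<open>D\<close> is fixed: the members of the block
must contain \<open>D\<close> if the element just placed is below the one in question, and avoid \<open>D\<close> otherwise.\<close>

definition restrict_family :: "bool \<Rightarrow> 'a set set \<Rightarrow> 'a set \<Rightarrow> 'a set set" where
  "restrict_family incl G D = (if incl then link G D {} else link G {} D)"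

lemma restrict_family_empty [simp]: "restrict_family incl G {} = G"
  by (simp add: restrict_family_def)

lemma restrict_family_subset_Pow: "G \<subseteq> Pow R \<Longrightarrow> restrict_family incl G D \<subseteq> Pow (R - D)"
  using link_subset_Pow[of G R D "{}"] link_subset_Pow[of G R "{}" D]
  by (simp add: restrict_family_def)

lemma mass_restrict_family_le:
  assumes "mass_bounded_on_subcubes R G K" "D \<subseteq> R"
  shows "mass (R - D) (restrict_family incl G D) \<le> K"
  using assms(1)[unfolded mass_bounded_on_subcubes_def, rule_format, of D "{}"]
    assms(1)[unfolded mass_bounded_on_subcubes_def, rule_format, of "{}" D] assms(2)
  by (simp add: restrict_family_def)

lemma mass_bounded_restrict_family:
  assumes b: "mass_bounded_on_subcubes R G K" and D: "D \<subseteq> R"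
  shows "mass_bounded_on_subcubes (R - D) (restrict_family incl G D) K"
  unfolding mass_bounded_on_subcubes_def
proof (intro allI impI)
  fix Y X assume YX: "Y \<subseteq> R - D" "X \<subseteq> R - D" "Y \<inter> X = {}"
  show "mass (R - D - (Y \<union> X)) (link (restrict_family incl G D) Y X) \<le> K"
  proof (cases incl)
    case True
    have "link (restrict_family incl G D) Y X = link G (D \<union> Y) X"
      using YX True by (subst restrict_family_def, simp, subst link_link) auto
    moreover have "mass (R - (D \<union> Y \<union> X)) (link G (D \<union> Y) X) \<le> K"
      by (rule b[unfolded mass_bounded_on_subcubes_def, rule_format]) (use YX D in auto)
    moreover have "R - (D \<union> Y \<union> X) = R - D - (Y \<union> X)" by auto
    ultimately show ?thesis by simp
  next
    case False
    have "link (restrict_family incl G D) Y X = link G Y (D \<union> X)"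
      using YX False by (subst restrict_family_def, simp, subst link_link) auto
    moreover have "mass (R - (Y \<union> (D \<union> X))) (link G Y (D \<union> X)) \<le> K"
      by (rule b[unfolded mass_bounded_on_subcubes_def, rule_format]) (use YX D in auto)
    moreover have "R - (Y \<union> (D \<union> X)) = R - D - (Y \<union> X)" by auto
    ultimately show ?thesis by simp
  qed
qed

lemma harmonic_restrict_family:
  assumes R: "finite R" and G: "G \<subseteq> Pow R"
    and incl: "incl \<Longrightarrow> \<forall>A\<in>G. z \<le> card A" and excl: "\<not> incl \<Longrightarrow> \<forall>A\<in>G. card A + z \<le> card R"
  shows "harmonic_below R z (\<lambda>D. mass (R - D) (restrict_family incl G D))"
  unfolding harmonic_below_def
proof (intro allI impI)
  fix D assume D: "D \<subseteq> R" "card D < z"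
  show "mass (R - D) (restrict_family incl G D) = mean_up R (\<lambda>D. mass (R - D) (restrict_family incl G D)) D"
  proof (cases incl)
    case True
    then have "D \<notin> G" using incl D(2) by (metis leD)
    then show ?thesis using mass_above_split[OF R G D(1)] True by (simp add: restrict_family_def)
  next
    case False
    have "card A + card D < card R" if "A \<in> G" for A
      using excl[OF False] that D(2) by (meson add_strict_left_mono order_less_le_trans)
    then show ?thesis using mass_avoiding_split[OF R G D(1)] False by (simp add: restrict_family_def)
  qed
qed

text \<open>If every member of \<open>H\<close> spoiled some family \<open>G j\<close>, then the sum of the squared deviations of the
masses, a submartingale, would be at least \<open>\<delta>\<^sup>2\<close> on \<open>H\<close>. Its expectation at level \<open>L\<close> is tiny by
\<open>harmonic_variance_decay\<close>, so \<open>mass_le_submartingale\<close> would force \<open>H\<close> to have mass below \<open>1/2\<close>.\<close>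

lemma good_choice:
  fixes G :: "'j \<Rightarrow> 'a set set"
  assumes R: "finite R" and H: "H \<subseteq> Pow R" "mass_bounded_on_subcubes R H K"
    and HL: "\<And>A. A \<in> H \<Longrightarrow> card A \<le> L" and massH: "mass R H \<ge> 1/2"
    and J: "finite J" and G: "\<And>j. j \<in> J \<Longrightarrow> G j \<subseteq> Pow R"
    and Gb: "\<And>j. j \<in> J \<Longrightarrow> mass_bounded_on_subcubes R (G j) K"
    and incl: "\<And>j. j \<in> J \<Longrightarrow> incl j \<Longrightarrow> \<forall>A\<in>G j. z \<le> card A"
    and excl: "\<And>j. j \<in> J \<Longrightarrow> \<not> incl j \<Longrightarrow> \<forall>A\<in>G j. card A + z \<le> card R"
    and z: "J \<noteq> {} \<Longrightarrow> z \<le> card R" and L: "L \<le> z" and K: "K > 0" and \<delta>: "\<delta> > 0"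
    and sep: "2 * real (card J) * K ^ 3 * real L < \<delta>\<^sup>2 * real z"
  shows "\<exists>D\<in>H. \<forall>j\<in>J. mass R (G j) - \<delta> \<le> mass (R - D) (restrict_family (incl j) (G j) D)"
proof (rule ccontr)
  assume neg: "\<not> ?thesis"
  define M where "M j D = mass (R - D) (restrict_family (incl j) (G j) D)" for j D
  have M0: "M j {} = mass R (G j)" for j unfolding M_def by simp
  have "H \<noteq> {}" using massH by (auto simp: mass_def)
  have bad: "\<exists>j\<in>J. M j D < M j {} - \<delta>" if "D \<in> H" for D
    using neg that unfolding M0 unfolding M_def by (meson not_le)
  have Jne: "J \<noteq> {}" using bad \<open>H \<noteq> {}\<close> by blast
  note z = z[OF Jne]
  have zpos: "z > 0"
  proof (rule ccontr)
    assume "\<not> z > 0"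
    then show False using sep L by simp
  qed
  define g where "g D = (\<Sum>j\<in>J. (M j D - M j {})\<^sup>2)" for D
  have harm: "harmonic_below R z (M j)" if "j \<in> J" for j
    unfolding M_def using harmonic_restrict_family[OF R G[OF that] incl[OF that] excl[OF that]] .
  have M_range: "0 \<le> M j D" "M j D \<le> K" if "j \<in> J" "D \<subseteq> R" for j D
    unfolding M_def using mass_nonneg mass_restrict_family_le[OF Gb[OF that(1)] that(2)] by auto
  have var: "real z * (mean_up R ^^ L) (\<lambda>D. (M j D - M j {})\<^sup>2) {} \<le> real L * K\<^sup>2" if "j \<in> J" for j
  proof (rule harmonic_variance_decay[OF R harm[OF that] z L])
    fix D assume "D \<subseteq> R"
    then show "\<bar>M j D - M j {}\<bar> \<le> K" using M_range[OF that, of D] M_range[OF that, of "{}"] by auto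
  qed
  have total: "real z * (mean_up R ^^ L) g {} \<le> real (card J) * (real L * K\<^sup>2)"
  proof -
    have "(mean_up R ^^ L) g {} = (\<Sum>j\<in>J. (mean_up R ^^ L) (\<lambda>D. (M j D - M j {})\<^sup>2) {})"
      unfolding g_def by (subst mean_up_pow_sum[OF J]) simp
    then have "real z * (mean_up R ^^ L) g {}
        = (\<Sum>j\<in>J. real z * (mean_up R ^^ L) (\<lambda>D. (M j D - M j {})\<^sup>2) {})"
      by (simp add: sum_distrib_left)
    also have "\<dots> \<le> (\<Sum>j\<in>J. real L * K\<^sup>2)" by (rule sum_mono) (rule var)
    finally show ?thesis by simp
  qed
  have "mass R H \<le> K / \<delta>\<^sup>2 * (mean_up R ^^ L) g {}"
  proof (rule mass_le_submartingale[OF R H(1) HL])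
    show "L \<le> card R" using L z by simp
    show "mass (R - D) (link H D {}) \<le> K" if "D \<subseteq> R" for D
      using mass_restrict_family_le[OF H(2) that, of True] by (simp add: restrict_family_def)
    show "0 \<le> g D" for D unfolding g_def by (intro sum_nonneg) simp
    show "g D \<le> mean_up R g D" if "D \<subseteq> R" "card D < L" for D
    proof -
      have "g D \<le> (\<Sum>j\<in>J. mean_up R (\<lambda>D. (M j D - M j {})\<^sup>2) D)"
        unfolding g_def
        by (rule sum_mono, rule harmonic_square_le_mean_up[OF R harm _ _ z]) (use that L in auto)
      also have "\<dots> = mean_up R g D" unfolding g_def using mean_up_pow_sum[OF J, where R = R and s = 1] by (simp add: fun_eq_iff)
      finally show ?thesis .
    qed
    show "\<delta>\<^sup>2 > 0" using \<delta> by simp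
    show "\<delta>\<^sup>2 \<le> g D" if "D \<in> H" for D
    proof -
      from bad[OF that] obtain j where j: "j \<in> J" "M j D < M j {} - \<delta>" by blast
      have "\<delta> \<le> \<bar>M j D - M j {}\<bar>" using j(2) by simp
      then have "\<delta>\<^sup>2 \<le> (M j D - M j {})\<^sup>2" using \<delta> by (metis less_imp_le power2_abs power_mono)
      also have "\<dots> \<le> g D" unfolding g_def using J j(1) by (intro member_le_sum) auto
      finally show ?thesis .
    qed
  qed
  then have "1/2 \<le> K / \<delta>\<^sup>2 * (mean_up R ^^ L) g {}" using massH by linarith
  then have "1/2 * (\<delta>\<^sup>2 * real z) \<le> K / \<delta>\<^sup>2 * (mean_up R ^^ L) g {} * (\<delta>\<^sup>2 * real z)"
    by (intro mult_right_mono) auto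
  also have "\<dots> = K * (real z * (mean_up R ^^ L) g {})" using \<delta> by (simp add: field_simps)
  also have "\<dots> \<le> K * (real (card J) * (real L * K\<^sup>2))" using total K by (intro mult_left_mono) auto
  also have "\<dots> = real (card J) * K ^ 3 * real L" by (simp add: power2_eq_square power3_eq_cube)
  finally show False using sep by simp
qed

text \<open>A partial order on \<open>{..<m}\<close> for which the usual order of the numbers is a linear extension; antisymmetry
follows from the second condition.\<close>

definition natural_order :: "nat \<Rightarrow> (nat \<Rightarrow> nat \<Rightarrow> bool) \<Rightarrow> bool" where
  "natural_order m le \<longleftrightarrow>
     (\<forall>i<m. le i i) \<and> (\<forall>i<m. \<forall>j<m. le i j \<longrightarrow> i \<le> j) \<and>
     (\<forall>i<m. \<forall>j<m. \<forall>k<m. le i j \<longrightarrow> le j k \<longrightarrow> le i k)"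

definition contains_order :: "nat \<Rightarrow> (nat \<Rightarrow> nat \<Rightarrow> bool) \<Rightarrow> 'a set set \<Rightarrow> bool" where
  "contains_order m le F \<longleftrightarrow> (\<exists>A. (\<forall>i<m. A i \<in> F) \<and> (\<forall>i<m. \<forall>j<m. A i \<subseteq> A j \<longleftrightarrow> le i j))"

text \<open>The increments with indices from \<open>i\<close> on are found by choosing \<open>E i\<close> with \<open>good_choice\<close> and applying
the statement for \<open>i + 1\<close> to the restricted families over the smaller ground set. The number \<open>t\<close> counts
the elements already used. Each of the at most \<open>m\<close> steps may cost a mass of \<open>1 / (2 m)\<close>, which keeps all masses at
least \<open>1/2\<close>. The requirement \<open>2 * hi j \<le> n\<close> leaves at least as much room above a block as below it; this is
what makes avoiding \<open>D\<close> as harmless as containing it.\<close>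

lemma disjoint_increments_exist:
  fixes lo hi :: "nat \<Rightarrow> nat" and m n C :: nat and K :: real
  assumes le: "\<And>j. j < m \<Longrightarrow> le j j"
    and block: "\<And>j. j < m \<Longrightarrow> 1 \<le> lo j \<and> lo j \<le> hi j \<and> 2 * hi j \<le> n"
    and gap: "\<And>i j. i < j \<Longrightarrow> j < m \<Longrightarrow> C * hi i \<le> lo j"
    and K: "K > 0" and C: "8 * real m ^ 3 * K ^ 3 + 1 < real C" "3 \<le> C" and "i \<le> m"
  shows "finite R \<Longrightarrow> n \<le> card R + t \<Longrightarrow> (i < m \<Longrightarrow> t < lo i) \<Longrightarrow>
    (\<And>j. i \<le> j \<Longrightarrow> j < m \<Longrightarrow> G j \<subseteq> Pow R \<and> mass_bounded_on_subcubes R (G j) K \<and>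
        1 - real i / (2 * real m) \<le> mass R (G j) \<and> (\<forall>A\<in>G j. lo j \<le> card A + t \<and> card A \<le> hi j)) \<Longrightarrow>
    \<exists>E :: nat \<Rightarrow> 'a set. (\<forall>j\<in>{i..<m}. E j \<subseteq> R \<and> E j \<noteq> {} \<and> (\<Union>q\<in>{q\<in>{i..j}. le q j}. E q) \<in> G j)
        \<and> disjoint_family_on E {i..<m}"
  using \<open>i \<le> m\<close>
proof (induction i arbitrary: R t G rule: inc_induct)
  case base
  then show ?case by (intro exI[of _ "\<lambda>_. {}"]) (simp add: disjoint_family_on_def)
next
  case (step i)
  note R = step.prems(1) and n = step.prems(2) and t = step.prems(3)[OF \<open>i < m\<close>]
  note G = step.prems(4)
  have im: "i < m" by fact
  define J where "J = {i<..<m}"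
  \<comment> \<open>The later masses are martingales for this many steps, because the members of later blocks and their complements in \<open>R\<close> all have at least \<open>z\<close> elements.\<close>
  define z where "z = (C - 1) * hi i"
  have hi1: "1 \<le> hi i" using block[OF im] by simp
  have C_eq: "C * hi i = z + hi i" unfolding z_def using C(2) by (simp add: algebra_simps)
  have "3 * hi i \<le> C * hi i" using C(2) by (intro mult_right_mono) auto
  then have z2: "2 * hi i \<le> z" using C_eq by linarith
  have sizes: "z + hi i \<le> lo j" "lo j \<le> hi j" "2 * hi j \<le> n" "t < hi i" if "j \<in> J" for j
    using gap[of i j] block[of j] block[OF im] t that C_eq unfolding J_def by auto
  have "\<exists>D\<in>G i. \<forall>j\<in>J. mass R (G j) - 1 / (2 * real m) \<le> mass (R - D) (restrict_family (le i j) (G j) D)"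
  proof (rule good_choice[where K = K and L = "hi i" and z = z])
    show "finite R" by (rule R)
    show "G i \<subseteq> Pow R" "mass_bounded_on_subcubes R (G i) K" using G[of i] im by auto
    show "card A \<le> hi i" if "A \<in> G i" for A using G[of i] im that by auto
    have "real i / (2 * real m) \<le> 1/2" using im by (simp add: field_simps)
    moreover have "1 - real i / (2 * real m) \<le> mass R (G i)" using G[of i] im by simp
    ultimately show "1/2 \<le> mass R (G i)" by linarith
    show "finite J" unfolding J_def by simp
    show "G j \<subseteq> Pow R" "mass_bounded_on_subcubes R (G j) K" if "j \<in> J" for j
      using G[of j] that unfolding J_def by auto
    show "\<forall>A\<in>G j. z \<le> card A" if "j \<in> J" for j
    proof
      fix A assume "A \<in> G j"
      then have "lo j \<le> card A + t" using G[of j] that unfolding J_def by auto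
      then show "z \<le> card A" using sizes[OF that] by linarith
    qed
    show "\<forall>A\<in>G j. card A + z \<le> card R" if "j \<in> J" for j
    proof
      fix A assume "A \<in> G j"
      then have "card A \<le> hi j" using G[of j] that unfolding J_def by auto
      then show "card A + z \<le> card R" using sizes[OF that] n by linarith
    qed
    show "z \<le> card R" if "J \<noteq> {}"
    proof -
      from that obtain j where "j \<in> J" by blast
      then show ?thesis using sizes[of j] n by linarith
    qed
    show "hi i \<le> z" using z2 by simp
    show "K > 0" "0 < 1 / (2 * real m)" using K im by auto
    have "card J \<le> m" unfolding J_def using card_mono[of "{..<m}" "{i<..<m}"] by auto
    then have "2 * real (card J) * K ^ 3 * real (hi i) \<le> 2 * real m * K ^ 3 * real (hi i)"
      using K by (intro mult_right_mono mult_left_mono) auto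
    also have "\<dots> = (1 / (2 * real m))\<^sup>2 * ((8 * real m ^ 3 * K ^ 3) * real (hi i))"
      using im by (simp add: power2_eq_square power3_eq_cube field_simps)
    also have "\<dots> < (1 / (2 * real m))\<^sup>2 * (real (C - 1) * real (hi i))"
      using C hi1 im by (intro mult_strict_left_mono mult_strict_right_mono) auto
    also have "\<dots> = (1 / (2 * real m))\<^sup>2 * real z" unfolding z_def by simp
    finally show "2 * real (card J) * K ^ 3 * real (hi i) < (1 / (2 * real m))\<^sup>2 * real z" .
  qed
  then obtain D where D: "D \<in> G i"
    "\<And>j. j \<in> J \<Longrightarrow> mass R (G j) - 1 / (2 * real m) \<le> mass (R - D) (restrict_family (le i j) (G j) D)"
    by blast
  have DR: "D \<subseteq> R" and cD: "lo i \<le> card D + t" "card D \<le> hi i" using G[of i] im D(1) by auto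
  have finD: "finite D" using DR R finite_subset by blast
  have Dne: "D \<noteq> {}" using cD(1) t by auto
  have cRD: "card (R - D) + card D = card R" using DR R by (simp add: card_Diff_subset card_mono finD)
  define G' where "G' j = restrict_family (le i j) (G j) D" for j
  have "\<exists>E :: nat \<Rightarrow> 'a set. (\<forall>j\<in>{Suc i..<m}. E j \<subseteq> R - D \<and> E j \<noteq> {} \<and> (\<Union>q\<in>{q\<in>{Suc i..j}. le q j}. E q) \<in> G' j)
        \<and> disjoint_family_on E {Suc i..<m}"
  proof (rule step.IH)
    show "finite (R - D)" using R by simp
    show "n \<le> card (R - D) + (t + card D)" using n cRD by simp
    show "t + card D < lo (Suc i)" if "Suc i < m"
    proof -
      have "z + hi i \<le> lo (Suc i)" "t < hi i" using sizes[of "Suc i"] that unfolding J_def by auto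
      then show ?thesis using cD(2) z2 by linarith
    qed
    fix j assume j: "Suc i \<le> j" "j < m"
    then have jJ: "j \<in> J" unfolding J_def by simp
    have Gj: "G j \<subseteq> Pow R" "mass_bounded_on_subcubes R (G j) K" "1 - real i / (2 * real m) \<le> mass R (G j)"
      "\<And>A. A \<in> G j \<Longrightarrow> lo j \<le> card A + t \<and> card A \<le> hi j" using G[of j] j by auto
    have "1 - real (Suc i) / (2 * real m) \<le> mass (R - D) (G' j)"
      using D(2)[OF jJ] Gj(3) unfolding G'_def by (simp add: add_divide_distrib)
    moreover have "lo j \<le> card A + (t + card D) \<and> card A \<le> hi j" if A: "A \<in> G' j" for A
    proof (cases "le i j")
      case True
      then have AD: "A \<inter> D = {}" "D \<union> A \<in> G j"
        using A unfolding G'_def restrict_family_def link_def by auto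
      then have "finite A" using Gj(1) R by (meson PowD finite_subset le_sup_iff subsetD)
      then have "card (D \<union> A) = card D + card A" using AD(1) finD by (simp add: card_Un_disjoint Int_commute)
      then show ?thesis using Gj(4)[OF AD(2)] by linarith
    next
      case False
      then have "A \<in> G j" using A unfolding G'_def restrict_family_def link_def by auto
      then show ?thesis using Gj(4)[of A] by linarith
    qed
    ultimately show "G' j \<subseteq> Pow (R - D) \<and> mass_bounded_on_subcubes (R - D) (G' j) K \<and>
        1 - real (Suc i) / (2 * real m) \<le> mass (R - D) (G' j) \<and>
        (\<forall>A\<in>G' j. lo j \<le> card A + (t + card D) \<and> card A \<le> hi j)"
      using restrict_family_subset_Pow[OF Gj(1)] mass_bounded_restrict_family[OF Gj(2) DR]
      unfolding G'_def by blast
  qed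
  then obtain E where E: "\<And>j. j \<in> {Suc i..<m} \<Longrightarrow> E j \<subseteq> R - D \<and> E j \<noteq> {} \<and> (\<Union>q\<in>{q\<in>{Suc i..j}. le q j}. E q) \<in> G' j"
    "disjoint_family_on E {Suc i..<m}" by blast
  define E' where "E' = E(i := D)"
  have "(\<Union>q\<in>{q\<in>{i..j}. le q j}. E' q) \<in> G j" if j: "j \<in> {i..<m}" for j
  proof (cases "j = i")
    case True
    then have "{q\<in>{i..j}. le q j} = {i}" using le[OF im] by auto
    then show ?thesis using True D(1) unfolding E'_def by simp
  next
    case False
    let ?U = "\<Union>q\<in>{q\<in>{Suc i..j}. le q j}. E q"
    have U: "?U \<in> G' j" using E(1)[of j] False j by auto
    have rest: "(\<Union>q\<in>{q\<in>{Suc i..j}. le q j}. E' q) = ?U" unfolding E'_def by (intro SUP_cong) auto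
    have "{q\<in>{i..j}. le q j} = (if le i j then {i} else {}) \<union> {q\<in>{Suc i..j}. le q j}"
      using j by (auto simp: le_eq_less_or_eq Suc_le_eq)
    then have "(\<Union>q\<in>{q\<in>{i..j}. le q j}. E' q) = (if le i j then D else {}) \<union> ?U"
      using rest by (auto simp: E'_def)
    then show ?thesis using U unfolding G'_def restrict_family_def link_def by (auto split: if_splits)
  qed
  moreover have "E' j \<subseteq> R \<and> E' j \<noteq> {}" if "j \<in> {i..<m}" for j
  proof (cases "j = i")
    case True
    then show ?thesis using DR Dne unfolding E'_def by simp
  next
    case False
    then have "j \<in> {Suc i..<m}" using that by simp
    from E(1)[OF this] have "E j \<subseteq> R" "E j \<noteq> {}" by blast+
    then show ?thesis using False unfolding E'_def by simp
  qed
  moreover have "disjoint_family_on E' {i..<m}"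
    unfolding disjoint_family_on_def
  proof (intro ballI impI)
    fix p q assume pq: "p \<in> {i..<m}" "q \<in> {i..<m}" "p \<noteq> q"
    have away: "D \<inter> E k = {}" if "k \<in> {i..<m}" "k \<noteq> i" for k
    proof -
      have "k \<in> {Suc i..<m}" using that by simp
      from E(1)[OF this] show ?thesis by blast
    qed
    show "E' p \<inter> E' q = {}"
    proof (cases "p = i \<or> q = i")
      case True
      then show ?thesis using pq away[of p] away[of q] unfolding E'_def by auto
    next
      case False
      then have "E p \<inter> E q = {}" using E(2) pq unfolding disjoint_family_on_def by auto
      then show ?thesis using False unfolding E'_def by auto
    qed
  qed
  ultimately show ?case by blast
qed

text \<open>The increment \<open>E i\<close> is nonempty and disjoint from all others, so it is contained in exactly those unions that
use the index \<open>i\<close>.\<close>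

lemma contains_order_of_disjoint_increments:
  assumes ord: "natural_order m le"
    and E: "\<And>j. j < m \<Longrightarrow> E j \<noteq> {} \<and> (\<Union>q\<in>{q\<in>{0..j}. le q j}. E q) \<in> F"
    and disj: "disjoint_family_on E {0..<m}"
  shows "contains_order m le F"
proof -
  define A where "A j = (\<Union>q\<in>{q\<in>{0..j}. le q j}. E q)" for j
  have "A i \<subseteq> A j \<longleftrightarrow> le i j" if ij: "i < m" "j < m" for i j
  proof
    assume "le i j"
    have "le q j \<and> q \<le> j" if "q \<le> i" "le q i" for q
    proof -
      have "q < m" using that(1) ij by simp
      then have "le q j" using ord \<open>le i j\<close> that(2) ij unfolding natural_order_def by blast
      then show ?thesis using ord \<open>q < m\<close> ij unfolding natural_order_def by blast
    qed
    then show "A i \<subseteq> A j" unfolding A_def by auto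
  next
    assume sub: "A i \<subseteq> A j"
    obtain x where x: "x \<in> E i" using E[OF ij(1)] by blast
    have "le i i" using ord ij unfolding natural_order_def by blast
    then have "x \<in> A i" using x unfolding A_def by auto
    then obtain q where q: "q \<le> j" "le q j" "x \<in> E q" using sub unfolding A_def by auto
    have "q = i"
    proof (rule ccontr)
      assume "q \<noteq> i"
      then have "E q \<inter> E i = {}" using disj q(1) ij unfolding disjoint_family_on_def by auto
      then show False using x q(3) by blast
    qed
    then show "le i j" using q(2) by simp
  qed
  moreover have "A i \<in> F" if "i < m" for i using E[OF that] unfolding A_def by simp
  ultimately show ?thesis unfolding contains_order_def by blast
qed

text \<open>The construction of the increments starts with no element used and with the blocks themselves as
families; restricting a family to a block of levels does not increase its mass on any subcube.\<close>

theorem separated_blocks_contain_order: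
  fixes lo hi :: "nat \<Rightarrow> nat" and F :: "'a set set"
  assumes ord: "natural_order m le" and V: "finite V" and F: "F \<subseteq> Pow V"
    and bound: "mass_bounded_on_subcubes V F K" and K: "K > 0"
    and block: "\<And>j. j < m \<Longrightarrow> 1 \<le> lo j \<and> lo j \<le> hi j \<and> 2 * hi j \<le> card V"
    and gap: "\<And>i j. i < j \<Longrightarrow> j < m \<Longrightarrow> C * hi i \<le> lo j"
    and heavy: "\<And>j. j < m \<Longrightarrow> 1 \<le> mass V {A\<in>F. lo j \<le> card A \<and> card A \<le> hi j}"
    and C: "8 * real m ^ 3 * K ^ 3 + 1 < real C" "3 \<le> C"
  shows "contains_order m le F"
proof -
  define G where "G j = {A\<in>F. lo j \<le> card A \<and> card A \<le> hi j}" for j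
  have le: "le j j" if "j < m" for j using ord that unfolding natural_order_def by blast
  have "mass_bounded_on_subcubes V (G j) K" for j
    unfolding mass_bounded_on_subcubes_def
  proof (intro allI impI)
    fix Y X assume YX: "Y \<subseteq> V" "X \<subseteq> V" "Y \<inter> X = {}"
    have "finite (link F Y X)" using finite_family[OF _ link_subset_Pow[OF F, of Y X]] V by simp
    then have "mass (V - (Y \<union> X)) (link (G j) Y X) \<le> mass (V - (Y \<union> X)) (link F Y X)"
      by (rule mass_mono) (auto simp: link_def G_def)
    then show "mass (V - (Y \<union> X)) (link (G j) Y X) \<le> K"
      using bound YX unfolding mass_bounded_on_subcubes_def by (meson order_trans)
  qed
  note Gb = this
  have "\<exists>E :: nat \<Rightarrow> 'a set. (\<forall>j\<in>{0..<m}. E j \<subseteq> V \<and> E j \<noteq> {} \<and> (\<Union>q\<in>{q\<in>{0..j}. le q j}. E q) \<in> G j)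
        \<and> disjoint_family_on E {0..<m}"
  proof (rule disjoint_increments_exist[where lo = lo and hi = hi and C = C and n = "card V"
        and K = K and le = le and t = 0])
    show "0 < lo 0" if "0 < m" using block[OF that] by simp
    fix j assume "j < m"
    then show "G j \<subseteq> Pow V \<and> mass_bounded_on_subcubes V (G j) K \<and>
        1 - real 0 / (2 * real m) \<le> mass V (G j) \<and> (\<forall>A\<in>G j. lo j \<le> card A + 0 \<and> card A \<le> hi j)"
      using F Gb[of j] heavy[of j] unfolding G_def by auto
  qed (use le block gap K C V in auto)
  then obtain E :: "nat \<Rightarrow> 'a set" where
    E: "\<forall>j\<in>{0..<m}. E j \<subseteq> V \<and> E j \<noteq> {} \<and> (\<Union>q\<in>{q\<in>{0..j}. le q j}. E q) \<in> G j"
    and disj: "disjoint_family_on E {0..<m}" by (elim exE conjE)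
  show ?thesis
  proof (rule contains_order_of_disjoint_increments[OF ord _ disj])
    fix j assume "j < m"
    with E have "E j \<noteq> {}" "(\<Union>q\<in>{q\<in>{0..j}. le q j}. E q) \<in> G j" by simp_all
    then show "E j \<noteq> {} \<and> (\<Union>q\<in>{q\<in>{0..j}. le q j}. E q) \<in> F" unfolding G_def by simp
  qed
qed

section \<open>Dyadic windows of levels\<close>

lemma permutation_moving_subset:
  assumes V: "finite V" and A: "A \<subseteq> V" and B: "B \<subseteq> V" and c: "card A = card B"
  shows "\<exists>\<tau>. \<tau> permutes V \<and> \<tau> ` A = B"
proof -
  have fin: "finite A" "finite B" using V A B finite_subset by auto
  obtain f where f: "bij_betw f A B" using finite_same_card_bij[OF fin c] by blast
  have "card (V - A) = card (V - B)" using A B c V fin by (simp add: card_Diff_subset)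
  then obtain g where g: "bij_betw g (V - A) (V - B)" using finite_same_card_bij[of "V - A" "V - B"] V by blast
  define \<tau> where "\<tau> x = (if x \<in> A then f x else if x \<in> V then g x else x)" for x
  have "bij_betw \<tau> A B" using f by (rule bij_betw_cong[THEN iffD1, rotated]) (simp add: \<tau>_def)
  moreover have "bij_betw \<tau> (V - A) (V - B)"
    using g by (rule bij_betw_cong[THEN iffD1, rotated]) (simp add: \<tau>_def)
  ultimately have "bij_betw \<tau> (A \<union> (V - A)) (B \<union> (V - B))" by (rule bij_betw_combine) blast
  moreover have "A \<union> (V - A) = V" "B \<union> (V - B) = V" using A B by auto
  ultimately have "\<tau> permutes V"
    by (intro bij_imp_permutes) (use A in \<open>auto simp: \<tau>_def\<close>)
  moreover have "\<tau> ` A = B" using \<open>bij_betw \<tau> A B\<close> by (simp add: bij_betw_def)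
  ultimately show ?thesis by blast
qed

text \<open>The image of a fixed set \<open>T\<close> under a random permutation is a uniformly random set of size \<open>card T\<close>.\<close>

lemma card_permutations_hitting:
  assumes V: "finite V" and F: "F \<subseteq> Pow V" and T: "T \<subseteq> V"
  shows "real (card {\<pi>. \<pi> permutes V \<and> \<pi> ` T \<in> F}) = fact (card V) * mass V {A\<in>F. card A = card T}"
proof -
  define t where "t = card T"
  define cnt where "cnt A = card {\<pi>. \<pi> permutes V \<and> \<pi> ` T = A}" for A
  have finP: "finite {\<pi>. \<pi> permutes V}" using V by (rule finite_permutations)
  have finP': "finite {\<pi>. \<pi> permutes V \<and> Q \<pi>}" for Q by (rule finite_subset[OF _ finP]) auto
  have le: "cnt A \<le> cnt B" if AB: "A \<subseteq> V" "B \<subseteq> V" "card A = card B" for A B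
  proof -
    obtain \<tau> where \<tau>: "\<tau> permutes V" "\<tau> ` A = B" using permutation_moving_subset[OF V AB] by blast
    have "inj_on (\<lambda>\<pi>. \<tau> \<circ> \<pi>) {\<pi>. \<pi> permutes V \<and> \<pi> ` T = A}"
    proof (rule inj_onI, rule ext)
      fix \<pi> \<pi>' x assume "\<tau> \<circ> \<pi> = \<tau> \<circ> \<pi>'"
      from fun_cong[OF this, of x] show "\<pi> x = \<pi>' x"
        using injD[OF permutes_inj[OF \<tau>(1)]] by simp
    qed
    moreover have "(\<lambda>\<pi>. \<tau> \<circ> \<pi>) ` {\<pi>. \<pi> permutes V \<and> \<pi> ` T = A} \<subseteq> {\<pi>. \<pi> permutes V \<and> \<pi> ` T = B}"
    proof (rule image_subsetI)
      fix \<pi> assume "\<pi> \<in> {\<pi>. \<pi> permutes V \<and> \<pi> ` T = A}"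
      then have \<pi>: "\<pi> permutes V" "\<pi> ` T = A" by simp_all
      have "(\<tau> \<circ> \<pi>) ` T = B" using \<pi>(2) \<tau>(2) by (simp only: image_comp[symmetric])
      then show "\<tau> \<circ> \<pi> \<in> {\<pi>. \<pi> permutes V \<and> \<pi> ` T = B}"
        using permutes_compose[OF \<pi>(1) \<tau>(1)] by simp
    qed
    ultimately show ?thesis unfolding cnt_def
      by (rule card_inj_on_le) (rule finP')
  qed
  have same: "cnt A = cnt T" if "A \<subseteq> V" "card A = t" for A
    using le[of A T] le[of T A] that T unfolding t_def by auto
  have sum: "card {\<pi>. \<pi> permutes V \<and> \<pi> ` T \<in> G} = card {A\<in>G. card A = t} * cnt T" if G: "G \<subseteq> Pow V" for G
  proof -
    have finG: "finite {A\<in>G. card A = t}" using finite_family[OF V G] by simp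
    have "{\<pi>. \<pi> permutes V \<and> \<pi> ` T \<in> G} = (\<Union>A\<in>{A\<in>G. card A = t}. {\<pi>. \<pi> permutes V \<and> \<pi> ` T = A})"
    proof -
      have "card (\<pi> ` T) = t" if "\<pi> permutes V" for \<pi>
        unfolding t_def by (rule card_image[OF inj_on_subset[OF permutes_inj[OF that]]]) simp
      then show ?thesis by auto
    qed
    also have "card \<dots> = (\<Sum>A\<in>{A\<in>G. card A = t}. cnt A)"
      unfolding cnt_def by (rule card_UN_disjoint[OF finG]) (use finP' in auto)
    also have "\<dots> = (\<Sum>A\<in>{A\<in>G. card A = t}. cnt T)" by (rule sum.cong) (use same G in auto)
    finally show ?thesis by simp
  qed
  have tn: "t \<le> card V" unfolding t_def using T V by (rule card_mono[rotated])
  have "\<pi> ` T \<in> Pow V" if "\<pi> permutes V" for \<pi> using permutes_image[OF that] T by blast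
  then have "{\<pi>. \<pi> permutes V \<and> \<pi> ` T \<in> Pow V} = {\<pi>. \<pi> permutes V}" by blast
  then have "fact (card V) = card {A\<in>Pow V. card A = t} * cnt T"
    using sum[of "Pow V"] card_permutations[OF refl V] by simp
  also have "{A\<in>Pow V. card A = t} = {A. A \<subseteq> V \<and> card A = t}" by auto
  also have "card \<dots> = card V choose t" by (rule n_subsets[OF V])
  finally have "fact (card V) = (card V choose t) * cnt T" .
  then have "(fact (card V) :: real) = real (card V choose t) * real (cnt T)"
    by (metis of_nat_fact of_nat_mult)
  moreover have "real (card V choose t) > 0" using tn by simp
  moreover have "mass V {A\<in>F. card A = t} = real (card {A\<in>F. card A = t}) / real (card V choose t)"
    unfolding mass_def by simp
  ultimately show ?thesis using sum[OF F] unfolding t_def by simp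
qed

text \<open>A grid point \<open>x\<close> encodes the union of the initial segments of lengths \<open>x i\<close> of \<open>m\<close> disjoint chains,
so inclusion is the coordinatewise order. The ranks realise \<open>le\<close> as an intersection of \<open>m\<close> linear orders:
the \<open>i\<close>-th one lists the elements not above \<open>i\<close> first and those above \<open>i\<close> afterwards. If \<open>a\<close> is not below \<open>b\<close>, then the
\<open>a\<close>-th order puts \<open>b\<close> before \<open>a\<close>.\<close>

lemma order_of_rank_pattern:
  assumes ord: "natural_order m le"
    and f: "inj_on f U" and S: "\<And>x. x \<in> S \<Longrightarrow> (SIGMA i:{..<m}. {..<x i}) \<subseteq> U"
    and SF: "\<And>x. x \<in> S \<Longrightarrow> f ` (SIGMA i:{..<m}. {..<x i}) \<in> F"
    and pat: "contains_rank_pattern {..<m} {..<m} (\<lambda>i q. (if le i q then m else 0) + q) S"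
  shows "contains_order m le F"
proof -
  obtain y where y: "\<forall>q\<in>{..<m}. y q \<in> S"
    and mono: "\<forall>i\<in>{..<m}. \<forall>a\<in>{..<m}. \<forall>b\<in>{..<m}.
      (if le i a then m else 0) + a < (if le i b then m else 0) + b \<longrightarrow> y a i < y b i"
    using pat unfolding contains_rank_pattern_def by (elim exE conjE)
  define A where "A q = f ` (SIGMA i:{..<m}. {..<y q i})" for q
  have sub: "A a \<subseteq> A b \<longleftrightarrow> (\<forall>i<m. y a i \<le> y b i)" if "a < m" "b < m" for a b
  proof -
    let ?G = "\<lambda>q. SIGMA i:{..<m}. {..<y q i}"
    have U: "?G q \<subseteq> U" if "q < m" for q using S y that by blast
    have "A a \<subseteq> A b \<longleftrightarrow> (SIGMA i:{..<m}. {..<y a i}) \<subseteq> (SIGMA i:{..<m}. {..<y b i})"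
    proof
      assume "A a \<subseteq> A b"
      then show "?G a \<subseteq> ?G b"
        unfolding A_def using inj_on_image_mem_iff[OF f _ U[OF that(2)]] U[OF that(1)] by blast
    qed (auto simp: A_def)
    also have "\<dots> \<longleftrightarrow> (\<forall>i<m. {..<y a i} \<subseteq> {..<y b i})" by (auto simp: subset_iff)
    finally show ?thesis by simp
  qed
  have "A a \<subseteq> A b \<longleftrightarrow> le a b" if ab: "a < m" "b < m" for a b
  proof
    assume l: "le a b"
    show "A a \<subseteq> A b"
    proof (cases "a = b")
      case False
      have "y a i < y b i" if i: "i < m" for i
      proof -
        have "le i a \<longrightarrow> le i b" using ord l ab i unfolding natural_order_def by blast
        moreover have "a < b" using ord l ab False unfolding natural_order_def
          by (metis le_neq_implies_less)
        ultimately show ?thesis using mono ab i by auto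
      qed
      then show ?thesis unfolding sub[OF ab] by (simp add: less_imp_le)
    qed simp
  next
    assume "A a \<subseteq> A b"
    then have le: "y a a \<le> y b a" using sub[OF ab] ab by blast
    show "le a b"
    proof (rule ccontr)
      assume n: "\<not> le a b"
      have "le a a" using ord ab unfolding natural_order_def by blast
      then have "y b a < y a a" using mono n ab by auto
      then show False using le by simp
    qed
  qed
  moreover have "A q \<in> F" if "q < m" for q using SF y that unfolding A_def by simp
  ultimately show ?thesis unfolding contains_order_def by blast
qed

lemma mass_levels_sum:
  assumes "finite F" "finite S"
  shows "mass V {A\<in>F. card A \<in> S} = (\<Sum>s\<in>S. mass V {A\<in>F. card A = s})"
proof -
  have "{A\<in>F. card A \<in> S} = (\<Union>s\<in>S. {A\<in>F. card A = s})" by auto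
  then show ?thesis unfolding mass_def using assms
    by (simp only:) (rule sum.UNION_disjoint, auto)
qed

text \<open>With \<open>d = m - 1\<close> and \<open>w = M div m\<close>, the grid has \<open>d\<close> short axes of length \<open>w\<close> and one long axis.
The short coordinates can be chosen freely, and the long one then adjusts the size to any
prescribed level \<open>s\<close> of the window; so each level contributes \<open>(w + 1) ^ d\<close> grid points. Averaging over
random placements of the grid, the family hits \<open>(w + 1) ^ d\<close> times its mass in the window, whereas no
placement allows more than \<open>c * (2 * M + 1) ^ d\<close> hits.\<close>

theorem mass_dyadic_window_bounded:
  assumes ord: "natural_order m le"
  shows "\<exists>W::real. \<forall>(V :: 'a set) F M. finite V \<longrightarrow> F \<subseteq> Pow V \<longrightarrow> \<not> contains_order m le F \<longrightarrow> 1 \<le> M \<longrightarrow>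
           mass V {A\<in>F. M \<le> card A \<and> card A \<le> 2 * M \<and> 2 * card A \<le> card V} \<le> W"
proof (cases m)
  case 0
  then show ?thesis by (simp add: contains_order_def)
next
  case (Suc d)
  let ?\<rho> = "\<lambda>i q. (if le i q then m else 0) + q"
  have "\<exists>c. \<forall>N S. S \<subseteq> PiE {..<m} (\<lambda>_. {..<N}) \<longrightarrow> \<not> contains_rank_pattern {..<m} {..<m} ?\<rho> S \<longrightarrow>
      card S \<le> c * N ^ (card {..<m} - 1)"
    by (rule hypermatrix_avoiding_rank_pattern) (use Suc in auto)
  then obtain c where "\<forall>N S. S \<subseteq> PiE {..<m} (\<lambda>_. {..<N}) \<longrightarrow>
      \<not> contains_rank_pattern {..<m} {..<m} ?\<rho> S \<longrightarrow> card S \<le> c * N ^ (card {..<m} - 1)"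
    by (elim exE)
  moreover have "card {..<m} - 1 = d" using Suc by simp
  ultimately have c: "card S \<le> c * N ^ d"
    if "S \<subseteq> PiE {..<m} (\<lambda>_. {..<N})" "\<not> contains_rank_pattern {..<m} {..<m} ?\<rho> S" for N S
    using that by simp
  have "mass V {A\<in>F. M \<le> card A \<and> card A \<le> 2 * M \<and> 2 * card A \<le> card V} \<le> real c * (3 * real m) ^ d"
    if V: "finite V" and F: "F \<subseteq> Pow V" and free: "\<not> contains_order m le F" and M: "1 \<le> M"
    for V :: "'a set" and F and M :: nat
  proof (cases "2 * M \<le> card V")
    case False
    then have "{A\<in>F. M \<le> card A \<and> card A \<le> 2 * M \<and> 2 * card A \<le> card V} = {}" by auto
    then show ?thesis unfolding mass_def by (simp only: sum.empty) simp
  next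
    case True
    define w where "w = M div m"
    define u where "u i = (if i < d then w else card V div 2)" for i
    define U where "U = (SIGMA i:{..<m}. {..<u i})"
    have "m * w \<le> M" unfolding w_def by simp
    then have dw: "d * w \<le> M" using Suc by simp
    have "M = m * w + M mod m" unfolding w_def by (rule mult_div_mod_eq[symmetric])
    moreover have "M mod m < m" using Suc by simp
    ultimately have Mw: "M \<le> m * (w + 1)" unfolding distrib_left mult_1_right by linarith
    have "card U = (\<Sum>i<m. u i)" unfolding U_def by simp
    also have "\<dots> = d * w + card V div 2" unfolding Suc by (simp add: u_def)
    also have "\<dots> \<le> card V" using dw True by linarith
    finally have cU: "card U \<le> card V" .
    have "finite U" unfolding U_def by simp
    from card_le_inj[OF this V cU] obtain e where e: "e ` U \<subseteq> V" "inj_on e U" by (elim exE conjE)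
    define T where "T x = e ` (SIGMA i:{..<m}. {..<x i})" for x :: "nat \<Rightarrow> nat"
    define levels where "levels = {s. M \<le> s \<and> s \<le> 2 * M \<and> 2 * s \<le> card V}"
    define Z where "Z = levels \<times> PiE {..<d} (\<lambda>_. {..w})"
    define \<phi> where "\<phi> = (\<lambda>(s, v :: nat \<Rightarrow> nat). (\<lambda>i\<in>{..<m}. if i < d then v i else s - (\<Sum>j<d. v j)))"
    have finl: "finite levels" unfolding levels_def by (rule finite_subset[of _ "{..2 * M}"]) auto
    then have finZ: "finite Z" unfolding Z_def by (auto intro!: finite_PiE)
    have side: "(\<Sum>j<d. v j) \<le> s" if "(s, v) \<in> Z" for s v
    proof -
      have "(\<Sum>j<d. v j) \<le> (\<Sum>j<d. w)" by (rule sum_mono) (use that in \<open>auto simp: Z_def\<close>)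
      then show ?thesis using dw that unfolding Z_def levels_def by auto
    qed
    \<comment> \<open>The pair of a level and the short coordinates determines a grid point; the subtraction in \<open>\<phi>\<close> never truncates.\<close>
    have \<phi>_inj: "inj_on \<phi> Z"
    proof (rule inj_onI, clarsimp)
      fix s v s' v' assume z: "(s, v) \<in> Z" "(s', v') \<in> Z" and eq: "\<phi> (s, v) = \<phi> (s', v')"
      have "v j = v' j" if "j < d" for j
        using fun_cong[OF eq, of j] that Suc unfolding \<phi>_def by simp
      then have "v = v'" using z unfolding Z_def by (auto intro!: PiE_ext[of v "{..<d}" _ v'])
      moreover have "s - (\<Sum>j<d. v j) = s' - (\<Sum>j<d. v' j)"
        using fun_cong[OF eq, of d] Suc unfolding \<phi>_def by simp
      ultimately show "s = s' \<and> v = v'" using side[OF z(1)] side[OF z(2)] by simp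
    qed
    have \<phi>_sum: "(\<Sum>i<m. \<phi> (s, v) i) = s" if "(s, v) \<in> Z" for s v
    proof -
      have "(\<Sum>i<m. \<phi> (s, v) i) = (\<Sum>i<d. v i) + (s - (\<Sum>j<d. v j))" unfolding Suc by (simp add: \<phi>_def Suc)
      then show ?thesis using side[OF that] by simp
    qed
    have \<phi>_box: "\<phi> z \<in> PiE {..<m} (\<lambda>_. {..<2 * M + 1})" and \<phi>_U: "(SIGMA i:{..<m}. {..<\<phi> z i}) \<subseteq> U"
      if "z \<in> Z" for z
    proof -
      obtain s v where z: "z = (s, v)" by (cases z)
      have s: "s \<le> 2 * M" "2 * s \<le> card V" and v: "\<And>j. j < d \<Longrightarrow> v j \<le> w"
        using that unfolding z Z_def levels_def by auto
      have "w \<le> M" unfolding w_def by simp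
      then have "v j \<le> 2 * M" if "j < d" for j using v[OF that] by simp
      then show "\<phi> z \<in> PiE {..<m} (\<lambda>_. {..<2 * M + 1})"
        using s unfolding z \<phi>_def by (auto simp: less_Suc_eq_le)
      have "\<phi> z i \<le> u i" if "i < m" for i using that s(2) v[of i] unfolding z \<phi>_def u_def by auto
      then show "(SIGMA i:{..<m}. {..<\<phi> z i}) \<subseteq> U" unfolding U_def by (fastforce intro: less_le_trans)
    qed
    have T_V: "T (\<phi> z) \<subseteq> V" if "z \<in> Z" for z unfolding T_def using \<phi>_U[OF that] e(1) by blast
    have T_card: "card (T (\<phi> (s, v))) = s" if "(s, v) \<in> Z" for s v
    proof -
      have "inj_on e (SIGMA i:{..<m}. {..<\<phi> (s, v) i})" using e(2) \<phi>_U[OF that] by (rule inj_on_subset)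
      then show ?thesis unfolding T_def using \<phi>_sum[OF that] by (simp add: card_image)
    qed
    have each: "card {z\<in>Z. \<pi> ` T (\<phi> z) \<in> F} \<le> c * (2 * M + 1) ^ d" if \<pi>: "\<pi> permutes V" for \<pi>
    proof -
      let ?S = "\<phi> ` {z\<in>Z. \<pi> ` T (\<phi> z) \<in> F}"
      have "card {z\<in>Z. \<pi> ` T (\<phi> z) \<in> F} = card ?S"
        by (rule card_image[symmetric]) (rule inj_on_subset[OF \<phi>_inj], auto)
      also have "\<dots> \<le> c * (2 * M + 1) ^ d"
      proof (rule c)
        show "?S \<subseteq> PiE {..<m} (\<lambda>_. {..<2 * M + 1})" using \<phi>_box by blast
        show "\<not> contains_rank_pattern {..<m} {..<m} ?\<rho> ?S"
        proof
          assume pat: "contains_rank_pattern {..<m} {..<m} ?\<rho> ?S"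
          have "inj_on (\<pi> \<circ> e) U"
            by (rule comp_inj_on[OF e(2) inj_on_subset[OF permutes_inj[OF \<pi>]]]) simp
          then have "contains_order m le F"
            by (rule order_of_rank_pattern[OF ord _ _ _ pat]) (use \<phi>_U in \<open>auto simp: T_def image_comp\<close>)
          then show False using free by simp
        qed
      qed
      finally show ?thesis .
    qed
    define P where "P = {\<pi>. \<pi> permutes V}"
    have finP: "finite P" unfolding P_def using V by (rule finite_permutations)
    have cardP: "card P = fact (card V)" unfolding P_def using card_permutations[OF refl V] .
    have "(\<Sum>\<pi>\<in>P. card {z\<in>Z. \<pi> ` T (\<phi> z) \<in> F}) = (\<Sum>z\<in>Z. card {\<pi>\<in>P. \<pi> ` T (\<phi> z) \<in> F})"
      using sum.swap_restrict[OF finP finZ, of "\<lambda>_ _. 1::nat" "\<lambda>\<pi> z. \<pi> ` T (\<phi> z) \<in> F"] by simp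
    then have count: "(\<Sum>z\<in>Z. card {\<pi>\<in>P. \<pi> ` T (\<phi> z) \<in> F}) \<le> card P * (c * (2 * M + 1) ^ d)"
      using sum_bounded_above[of P "\<lambda>\<pi>. card {z\<in>Z. \<pi> ` T (\<phi> z) \<in> F}" "c * (2 * M + 1) ^ d"] each
      unfolding P_def by simp
    have "real (\<Sum>z\<in>Z. card {\<pi>\<in>P. \<pi> ` T (\<phi> z) \<in> F}) \<le> real (card P * (c * (2 * M + 1) ^ d))"
      using count by (simp only: of_nat_le_iff)
    also have "\<dots> = fact (card V) * (real c * real ((2 * M + 1) ^ d))"
      unfolding cardP by (simp only: of_nat_mult of_nat_fact)
    finally have count': "real (\<Sum>z\<in>Z. card {\<pi>\<in>P. \<pi> ` T (\<phi> z) \<in> F})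
        \<le> fact (card V) * (real c * real ((2 * M + 1) ^ d))" .
    have "real (\<Sum>z\<in>Z. card {\<pi>\<in>P. \<pi> ` T (\<phi> z) \<in> F}) = (\<Sum>(s, v)\<in>Z. fact (card V) * mass V {A\<in>F. card A = s})"
      unfolding of_nat_sum
    proof (rule sum.cong[OF refl], clarify)
      fix s v assume z: "(s, v) \<in> Z"
      show "real (card {\<pi>\<in>P. \<pi> ` T (\<phi> (s, v)) \<in> F}) = fact (card V) * mass V {A\<in>F. card A = s}"
        using card_permutations_hitting[OF V F T_V[OF z]] T_card[OF z] unfolding P_def by simp
    qed
    also have "\<dots> = (\<Sum>s\<in>levels. real ((w + 1) ^ d) * (fact (card V) * mass V {A\<in>F. card A = s}))"
      unfolding Z_def by (simp add: sum.cartesian_product[symmetric] card_PiE)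
    also have "\<dots> = real ((w + 1) ^ d) * fact (card V) * mass V {A\<in>F. card A \<in> levels}"
      using finite_family[OF V F] finl by (simp add: mass_levels_sum sum_distrib_left mult_ac)
    finally have "real (\<Sum>z\<in>Z. card {\<pi>\<in>P. \<pi> ` T (\<phi> z) \<in> F})
        = real ((w + 1) ^ d) * fact (card V) * mass V {A\<in>F. card A \<in> levels}" .
    then have "real ((w + 1) ^ d) * fact (card V) * mass V {A\<in>F. card A \<in> levels}
        \<le> fact (card V) * (real c * real ((2 * M + 1) ^ d))"
      using count' by (simp only:)
    then have "real ((w + 1) ^ d) * mass V {A\<in>F. card A \<in> levels} \<le> real c * real ((2 * M + 1) ^ d)"
      using mult_le_cancel_left_pos[of "fact (card V) :: real" "real ((w + 1) ^ d) * mass V {A\<in>F. card A \<in> levels}"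
          "real c * real ((2 * M + 1) ^ d)"] fact_gt_zero[where 'a = real]
      by (simp only: mult_ac)
    also have "(2 * M + 1) ^ d \<le> (3 * (m * (w + 1))) ^ d" using M Mw by (intro power_mono) auto
    then have "real c * real ((2 * M + 1) ^ d) \<le> real c * real ((3 * (m * (w + 1))) ^ d)"
      by (intro mult_left_mono) (simp_all only: of_nat_le_iff of_nat_0_le_iff)
    also have "\<dots> = real ((w + 1) ^ d) * (real c * (3 * real m) ^ d)"
    proof -
      have "(3 * (m * (w + 1))) ^ d = (3 * m) ^ d * (w + 1) ^ d"
        by (simp only: power_mult_distrib[symmetric] mult.assoc)
      then show ?thesis by (simp only: of_nat_mult of_nat_power of_nat_numeral mult_ac)
    qed
    finally have "mass V {A\<in>F. card A \<in> levels} \<le> real c * (3 * real m) ^ d"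
      by (rule mult_left_le_imp_le) simp
    then show ?thesis unfolding levels_def by simp
  qed
  then show ?thesis by blast
qed

section \<open>The lower half of the cube\<close>

lemma mass_level_le_1:
  assumes V: "finite V" and F: "F \<subseteq> Pow V"
  shows "mass V {A\<in>F. card A = s} \<le> 1"
proof -
  have sub: "{A\<in>F. card A = s} \<subseteq> {A. A \<subseteq> V \<and> card A = s}" using F by auto
  have "card {A\<in>F. card A = s} \<le> card {A. A \<subseteq> V \<and> card A = s}"
    by (rule card_mono[OF _ sub]) (use V in simp)
  also have "\<dots> = card V choose s" by (rule n_subsets[OF V])
  finally have "card {A\<in>F. card A = s} \<le> card V choose s" .
  moreover have "mass V {A\<in>F. card A = s} = real (card {A\<in>F. card A = s}) / real (card V choose s)"
    unfolding mass_def by simp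
  ultimately show ?thesis by (simp add: divide_le_eq)
qed

text \<open>The gap is covered by \<open>T\<close> dyadic windows.\<close>

lemma mass_gap:
  assumes fin: "finite F" and h: "1 \<le> h" and W: "0 \<le> W"
    and window: "\<And>M. 1 \<le> M \<Longrightarrow> mass V {A\<in>F. M \<le> card A \<and> card A \<le> 2 * M \<and> 2 * card A \<le> card V} \<le> W"
  shows "mass V {A\<in>F. h < card A \<and> card A \<le> 2 ^ T * h \<and> 2 * card A \<le> card V} \<le> real T * W"
proof (induction T)
  case 0
  have "{A\<in>F. h < card A \<and> card A \<le> 2 ^ 0 * h \<and> 2 * card A \<le> card V} = {}" by auto
  then show ?case unfolding mass_def by (simp only: sum.empty)
next
  case (Suc T)
  let ?near = "{A\<in>F. h < card A \<and> card A \<le> 2 ^ T * h \<and> 2 * card A \<le> card V}"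
  let ?far = "{A\<in>F. 2 ^ T * h \<le> card A \<and> card A \<le> 2 * (2 ^ T * h) \<and> 2 * card A \<le> card V}"
  have "mass V {A\<in>F. h < card A \<and> card A \<le> 2 ^ Suc T * h \<and> 2 * card A \<le> card V} \<le> mass V (?near \<union> ?far)"
  proof (rule mass_mono)
    show "finite (?near \<union> ?far)" using fin by simp
  qed auto
  also have "\<dots> \<le> mass V ?near + mass V ?far" by (rule mass_Un_le) (use fin in auto)
  also have "mass V ?far \<le> W" by (rule window) (use h in simp)
  finally show ?case using Suc by (simp add: algebra_simps)
qed

text \<open>Greedy choice: a block ends as soon as its mass reaches \<open>1\<close>, hence it has mass at most \<open>2\<close>, because a
single level has mass at most \<open>1\<close>. The gap of ratio \<open>2 ^ T\<close> after it costs at most \<open>T * W\<close>, and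
the search continues above the gap.\<close>

lemma heavy_blocks_exist:
  fixes W :: real
  assumes V: "finite V" and F: "F \<subseteq> Pow V" and W: "0 \<le> W"
    and window: "\<And>M. 1 \<le> M \<Longrightarrow> mass V {A\<in>F. M \<le> card A \<and> card A \<le> 2 * M \<and> 2 * card A \<le> card V} \<le> W"
  shows "1 \<le> l \<Longrightarrow> real r * (2 + real T * W) < mass V {A\<in>F. l \<le> card A \<and> 2 * card A \<le> card V} \<Longrightarrow>
    \<exists>lo hi :: nat \<Rightarrow> nat. (\<forall>j<r. l \<le> lo j \<and> lo j \<le> hi j \<and> 2 * hi j \<le> card V \<and>
        1 \<le> mass V {A\<in>F. lo j \<le> card A \<and> card A \<le> hi j}) \<and>
      (\<forall>i j. i < j \<longrightarrow> j < r \<longrightarrow> 2 ^ T * hi i \<le> lo j)"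
proof (induction r arbitrary: l)
  case 0
  then show ?case by simp
next
  case (Suc r)
  have fin: "finite F" using finite_family[OF V F] .
  define B where "B h = mass V {A\<in>F. l \<le> card A \<and> card A \<le> h \<and> 2 * card A \<le> card V}" for h
  define h where "h = (LEAST h. 1 \<le> B h)"
  have "{A\<in>F. l \<le> card A \<and> card A \<le> card V \<and> 2 * card A \<le> card V} = {A\<in>F. l \<le> card A \<and> 2 * card A \<le> card V}"
    by auto
  moreover have "1 \<le> real (Suc r) * (2 + real T * W)"
  proof -
    have "1 * 1 \<le> real (Suc r) * (2 + real T * W)" using W by (intro mult_mono) auto
    then show ?thesis by simp
  qed
  ultimately have "1 \<le> B (card V)" unfolding B_def using Suc.prems(2) by simp
  then have Bh: "1 \<le> B h" unfolding h_def by (rule LeastI)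
  have B_less: "B k < 1" if "k < h" for k
    using not_less_Least[of k "\<lambda>h. 1 \<le> B h"] that unfolding h_def by simp
  have lh: "l \<le> h"
  proof (rule ccontr)
    assume "\<not> l \<le> h"
    then have "{A\<in>F. l \<le> card A \<and> card A \<le> h \<and> 2 * card A \<le> card V} = {}" by auto
    then have "B h = 0" unfolding B_def mass_def by (simp only: sum.empty)
    then show False using Bh by simp
  qed
  then have h1: "1 \<le> h" using Suc.prems(1) by simp
  have hV: "2 * h \<le> card V"
  proof (rule ccontr)
    assume "\<not> 2 * h \<le> card V"
    then have "{A\<in>F. l \<le> card A \<and> card A \<le> h \<and> 2 * card A \<le> card V}
        = {A\<in>F. l \<le> card A \<and> card A \<le> h - 1 \<and> 2 * card A \<le> card V}" by (auto simp: le_less)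
    then have "B h = B (h - 1)" unfolding B_def by (simp only:)
    then show False using B_less[of "h - 1"] Bh h1 by simp
  qed
  have B2: "B h \<le> 2"
  proof -
    have "B h \<le> mass V ({A\<in>F. l \<le> card A \<and> card A \<le> h - 1 \<and> 2 * card A \<le> card V} \<union> {A\<in>F. card A = h})"
      unfolding B_def by (rule mass_mono) (use fin in auto)
    also have "\<dots> \<le> B (h - 1) + mass V {A\<in>F. card A = h}"
      unfolding B_def by (rule mass_Un_le) (use fin in auto)
    also have "\<dots> \<le> 2" using B_less[of "h - 1"] h1 mass_level_le_1[OF V F, of h] by simp
    finally show ?thesis .
  qed
  \<comment> \<open>The next block may start above the gap \<open>{h<..2 ^ T * h}\<close>.\<close>
  define l' where "l' = 2 ^ T * h + 1"
  let ?gap = "{A\<in>F. h < card A \<and> card A \<le> 2 ^ T * h \<and> 2 * card A \<le> card V}"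
  let ?rest = "{A\<in>F. l' \<le> card A \<and> 2 * card A \<le> card V}"
  have "mass V {A\<in>F. l \<le> card A \<and> 2 * card A \<le> card V}
      \<le> mass V ({A\<in>F. l \<le> card A \<and> card A \<le> h \<and> 2 * card A \<le> card V} \<union> (?gap \<union> ?rest))"
    by (rule mass_mono) (use fin in \<open>auto simp: l'_def\<close>)
  also have "\<dots> \<le> B h + mass V (?gap \<union> ?rest)" unfolding B_def by (rule mass_Un_le) (use fin in auto)
  also have "mass V (?gap \<union> ?rest) \<le> mass V ?gap + mass V ?rest" by (rule mass_Un_le) (use fin in auto)
  also have "mass V ?gap \<le> real T * W" by (rule mass_gap[OF fin h1 W window])
  finally have "real (Suc r) * (2 + real T * W) < 2 + (real T * W + mass V ?rest)"
    using Suc.prems(2) B2 by linarith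
  then have rest: "real r * (2 + real T * W) < mass V ?rest" by (simp add: algebra_simps)
  have "1 \<le> l'" unfolding l'_def by simp
  from Suc.IH[OF this rest] obtain lo hi :: "nat \<Rightarrow> nat" where
    IH: "\<forall>j<r. l' \<le> lo j \<and> lo j \<le> hi j \<and> 2 * hi j \<le> card V \<and> 1 \<le> mass V {A\<in>F. lo j \<le> card A \<and> card A \<le> hi j}"
    and gaps: "\<forall>i j. i < j \<longrightarrow> j < r \<longrightarrow> 2 ^ T * hi i \<le> lo j"
    by (elim exE conjE)
  define lo' hi' where "lo' = case_nat l lo" and "hi' = case_nat h hi"
  have "h \<le> 2 ^ T * h" by simp
  then have ll': "l \<le> l'" unfolding l'_def using lh by linarith
  have first: "1 \<le> mass V {A\<in>F. l \<le> card A \<and> card A \<le> h}"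
  proof -
    have "B h \<le> mass V {A\<in>F. l \<le> card A \<and> card A \<le> h}"
      unfolding B_def by (rule mass_mono) (use fin in auto)
    then show ?thesis using Bh by linarith
  qed
  have "l \<le> lo' j \<and> lo' j \<le> hi' j \<and> 2 * hi' j \<le> card V \<and> 1 \<le> mass V {A\<in>F. lo' j \<le> card A \<and> card A \<le> hi' j}"
    if "j < Suc r" for j
  proof (cases j)
    case 0
    then show ?thesis using first lh hV unfolding lo'_def hi'_def by simp
  next
    case (Suc k)
    then have "k < r" using that by simp
    then show ?thesis using IH ll' Suc unfolding lo'_def hi'_def by (auto intro: order_trans)
  qed
  moreover have "2 ^ T * hi' i \<le> lo' j" if "i < j" "j < Suc r" for i j
  proof -
    obtain k where k: "j = Suc k" "k < r" using \<open>i < j\<close> \<open>j < Suc r\<close> by (cases j) auto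
    show ?thesis
    proof (cases i)
      case 0
      have "l' \<le> lo k" using IH k(2) by blast
      then show ?thesis using 0 k unfolding lo'_def hi'_def l'_def by simp
    next
      case (Suc i')
      then show ?thesis using gaps k \<open>i < j\<close> unfolding lo'_def hi'_def by simp
    qed
  qed
  ultimately show ?case by blast
qed

text \<open>Level \<open>0\<close> is set aside, since ratios of levels are meaningless there. More mass than stated on the remaining levels would
yield \<open>m\<close> heavy, well separated blocks, and with them the forbidden order.\<close>

lemma mass_lower_half:
  fixes W :: real
  assumes ord: "natural_order m le" and V: "finite V" and F: "F \<subseteq> Pow V"
    and free: "\<not> contains_order m le F" and W: "0 \<le> W"
    and window: "\<And>M. 1 \<le> M \<Longrightarrow> mass V {A\<in>F. M \<le> card A \<and> card A \<le> 2 * M \<and> 2 * card A \<le> card V} \<le> W"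
    and bound: "mass_bounded_on_subcubes V F K" and K: "K > 0"
    and T: "8 * real m ^ 3 * K ^ 3 + 1 < 2 ^ T" "3 \<le> (2::nat) ^ T"
  shows "mass V {A\<in>F. 2 * card A \<le> card V} \<le> 1 + real m * (2 + real T * W)"
proof -
  have fin: "finite F" using finite_family[OF V F] .
  have tail: "mass V {A\<in>F. 1 \<le> card A \<and> 2 * card A \<le> card V} \<le> real m * (2 + real T * W)"
  proof (rule ccontr)
    assume "\<not> ?thesis"
    then have "real m * (2 + real T * W) < mass V {A\<in>F. 1 \<le> card A \<and> 2 * card A \<le> card V}" by simp
    from heavy_blocks_exist[OF V F W _ order_refl this] window
    have "\<exists>lo hi :: nat \<Rightarrow> nat. (\<forall>j<m. 1 \<le> lo j \<and> lo j \<le> hi j \<and> 2 * hi j \<le> card V \<and>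
        1 \<le> mass V {A\<in>F. lo j \<le> card A \<and> card A \<le> hi j}) \<and>
      (\<forall>i j. i < j \<longrightarrow> j < m \<longrightarrow> 2 ^ T * hi i \<le> lo j)" by simp
    then obtain lo hi :: "nat \<Rightarrow> nat" where
      bl: "\<forall>j<m. 1 \<le> lo j \<and> lo j \<le> hi j \<and> 2 * hi j \<le> card V \<and> 1 \<le> mass V {A\<in>F. lo j \<le> card A \<and> card A \<le> hi j}"
      and gaps: "\<forall>i j. i < j \<longrightarrow> j < m \<longrightarrow> 2 ^ T * hi i \<le> lo j" by (elim exE conjE)
    have "contains_order m le F"
      by (rule separated_blocks_contain_order[OF ord V F bound K, where lo = lo and hi = hi and C = "2 ^ T"])
        (use bl gaps T in auto)
    then show False using free by simp
  qed
  have "mass V {A\<in>F. 2 * card A \<le> card V}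
      \<le> mass V ({A\<in>F. card A = 0} \<union> {A\<in>F. 1 \<le> card A \<and> 2 * card A \<le> card V})"
    by (rule mass_mono) (use fin in auto)
  also have "\<dots> \<le> mass V {A\<in>F. card A = 0} + mass V {A\<in>F. 1 \<le> card A \<and> 2 * card A \<le> card V}"
    by (rule mass_Un_le) (use fin in auto)
  finally show ?thesis using tail mass_level_le_1[OF V F, of 0] by linarith
qed

section \<open>Complements and the dual order\<close>

definition complements :: "'a set \<Rightarrow> 'a set set \<Rightarrow> 'a set set" where
  "complements V F = (\<lambda>A. V - A) ` F"

text \<open>The indices are reversed together with the order, which keeps the usual order of the numbers a linear
extension.\<close>

definition dual_order :: "nat \<Rightarrow> (nat \<Rightarrow> nat \<Rightarrow> bool) \<Rightarrow> nat \<Rightarrow> nat \<Rightarrow> bool" where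
  "dual_order m le i j = le (m - 1 - j) (m - 1 - i)"

lemma natural_order_dual:
  assumes "natural_order m le"
  shows "natural_order m (dual_order m le)"
  unfolding natural_order_def
proof (intro conjI allI impI)
  have rev: "m - 1 - i < m" if "i < m" for i using that by simp
  fix i j k assume i: "i < m"
  show "dual_order m le i i" unfolding dual_order_def using assms rev[OF i] by (simp add: natural_order_def)
  assume j: "j < m" and ij: "dual_order m le i j"
  have "m - 1 - j \<le> m - 1 - i" using assms rev[OF i] rev[OF j] ij unfolding dual_order_def natural_order_def by blast
  then show "i \<le> j" using i j by simp
  assume k: "k < m" and jk: "dual_order m le j k"
  show "dual_order m le i k"
    using assms rev[OF i] rev[OF j] rev[OF k] ij jk unfolding dual_order_def natural_order_def by blast
qed

lemma contains_order_complements: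
  assumes F: "F \<subseteq> Pow V" and c: "contains_order m (dual_order m le) (complements V F)"
  shows "contains_order m le F"
proof -
  obtain B where B: "\<forall>i<m. B i \<in> complements V F" "\<forall>i<m. \<forall>j<m. B i \<subseteq> B j \<longleftrightarrow> dual_order m le i j"
    using c unfolding contains_order_def by (elim exE conjE)
  define A where "A i = V - B (m - 1 - i)" for i
  have rev: "m - 1 - i < m" "m - 1 - (m - 1 - i) = i" if "i < m" for i using that by auto
  have BV: "B i \<subseteq> V" "V - B i \<in> F" if "i < m" for i
  proof -
    have "B i \<in> complements V F" using B(1) that by blast
    then obtain A where "A \<in> F" "B i = V - A" unfolding complements_def by blast
    moreover have "A \<subseteq> V" using \<open>A \<in> F\<close> F by auto
    ultimately show "B i \<subseteq> V" "V - B i \<in> F" by (auto simp: double_diff)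
  qed
  have "A i \<subseteq> A j \<longleftrightarrow> le i j" if ij: "i < m" "j < m" for i j
  proof -
    have "A i \<subseteq> A j \<longleftrightarrow> B (m - 1 - j) \<subseteq> B (m - 1 - i)"
      unfolding A_def using BV(1)[OF rev(1)[OF ij(1)]] BV(1)[OF rev(1)[OF ij(2)]] by blast
    also have "\<dots> \<longleftrightarrow> dual_order m le (m - 1 - j) (m - 1 - i)" using B(2) rev(1) ij by blast
    also have "\<dots> \<longleftrightarrow> le i j" unfolding dual_order_def using rev(2) ij by simp
    finally show ?thesis .
  qed
  moreover have "A i \<in> F" if "i < m" for i unfolding A_def using BV(2) rev(1)[OF that] by blast
  ultimately show ?thesis unfolding contains_order_def by blast
qed

lemma mass_complements:
  assumes V: "finite V" and F: "F \<subseteq> Pow V"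
  shows "mass V (complements V F) = mass V F"
proof -
  have "inj_on (\<lambda>A. V - A) F" using F by (auto intro!: inj_onI)
  then have "mass V (complements V F) = (\<Sum>A\<in>F. 1 / real (card V choose card (V - A)))"
    unfolding mass_def complements_def by (simp add: sum.reindex)
  also have "\<dots> = mass V F"
    unfolding mass_def
  proof (rule sum.cong[OF refl])
    fix A assume "A \<in> F"
    then have A: "A \<subseteq> V" using F by auto
    then have "card (V - A) = card V - card A" "card A \<le> card V"
      using V by (simp_all add: card_Diff_subset finite_subset card_mono)
    then show "1 / real (card V choose card (V - A)) = 1 / real (card V choose card A)"
      using binomial_symmetric[of "card A" "card V"] by simp
  qed
  finally show ?thesis .
qed

lemma link_complements:
  assumes F: "F \<subseteq> Pow V" and Y: "Y \<subseteq> V" and X: "X \<subseteq> V" and YX: "Y \<inter> X = {}"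
  shows "link (complements V F) Y X = complements (V - (Y \<union> X)) (link F X Y)"
proof
  show "link (complements V F) Y X \<subseteq> complements (V - (Y \<union> X)) (link F X Y)"
  proof
    fix E assume E: "E \<in> link (complements V F) Y X"
    then obtain A where A: "A \<in> F" "Y \<union> E = V - A" and dis: "E \<inter> (Y \<union> X) = {}"
      unfolding link_def complements_def by auto
    let ?D = "V - (Y \<union> X) - E"
    have AV: "A \<subseteq> V" using A(1) F by auto
    have "X \<union> ?D = A" using A(2) AV dis X YX by blast
    then have "?D \<in> link F X Y" using A(1) dis unfolding link_def by auto
    moreover have "E = V - (Y \<union> X) - ?D" using A(2) dis by blast
    ultimately show "E \<in> complements (V - (Y \<union> X)) (link F X Y)" unfolding complements_def by blast
  qed
  show "complements (V - (Y \<union> X)) (link F X Y) \<subseteq> link (complements V F) Y X"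
  proof
    fix E assume "E \<in> complements (V - (Y \<union> X)) (link F X Y)"
    then obtain D where D: "D \<inter> (X \<union> Y) = {}" "X \<union> D \<in> F" "E = V - (Y \<union> X) - D"
      unfolding link_def complements_def by auto
    have "D \<subseteq> V" using D(2) F by auto
    then have "Y \<union> E = V - (X \<union> D)" using D(1,3) X Y YX by blast
    then show "E \<in> link (complements V F) Y X" using D(2,3) unfolding link_def complements_def by blast
  qed
qed

lemma mass_bounded_complements:
  assumes V: "finite V" and F: "F \<subseteq> Pow V" and b: "mass_bounded_on_subcubes V F K"
  shows "mass_bounded_on_subcubes V (complements V F) K"
  unfolding mass_bounded_on_subcubes_def
proof (intro allI impI)
  fix Y X assume YX: "Y \<subseteq> V" "X \<subseteq> V" "Y \<inter> X = {}"
  have "link F X Y \<subseteq> Pow (V - (Y \<union> X))" using link_subset_Pow[OF F, of X Y] by (simp add: Un_commute)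
  then have "mass (V - (Y \<union> X)) (link (complements V F) Y X) = mass (V - (X \<union> Y)) (link F X Y)"
    unfolding link_complements[OF F YX] using V by (simp add: mass_complements Un_commute)
  also have "\<dots> \<le> K" by (rule b[unfolded mass_bounded_on_subcubes_def, rule_format]) (use YX in auto)
  finally show "mass (V - (Y \<union> X)) (link (complements V F) Y X) \<le> K" .
qed

lemma contains_order_link:
  assumes "contains_order m le (link F Y X)"
  shows "contains_order m le F"
proof -
  obtain D where D: "\<forall>i<m. D i \<in> link F Y X" "\<forall>i<m. \<forall>j<m. D i \<subseteq> D j \<longleftrightarrow> le i j"
    using assms unfolding contains_order_def by (elim exE conjE)
  have Di: "D i \<inter> Y = {}" "Y \<union> D i \<in> F" if "i < m" for i using D(1) that unfolding link_def by blast+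
  have "Y \<union> D i \<subseteq> Y \<union> D j \<longleftrightarrow> le i j" if "i < m" "j < m" for i j
    using D(2) Di(1)[OF that(1)] Di(1)[OF that(2)] that by blast
  then show ?thesis unfolding contains_order_def using Di(2) by (intro exI[of _ "\<lambda>i. Y \<union> D i"]) blast
qed

section \<open>The uniform bound\<close>

text \<open>Only the whole cube is not covered by the hypothesis. After the first element of the random chain
the chain runs in a smaller cube, so at most one further member, the empty set, is gained.\<close>

lemma mass_bounded_of_smaller_cubes:
  assumes V: "finite V" and F: "F \<subseteq> Pow V" and K: "0 \<le> K"
    and small: "\<And>Y X. Y \<subseteq> V \<Longrightarrow> X \<subseteq> V \<Longrightarrow> Y \<inter> X = {} \<Longrightarrow> Y \<union> X \<noteq> {} \<Longrightarrow>
      mass (V - (Y \<union> X)) (link F Y X) \<le> K"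
  shows "mass_bounded_on_subcubes V F (K + 1)"
  unfolding mass_bounded_on_subcubes_def
proof (intro allI impI)
  fix Y X assume YX: "Y \<subseteq> V" "X \<subseteq> V" "Y \<inter> X = {}"
  show "mass (V - (Y \<union> X)) (link F Y X) \<le> K + 1"
  proof (cases "Y \<union> X = {}")
    case False
    then show ?thesis using small[OF YX] by simp
  next
    case True
    have "(\<Sum>b\<in>V. mass (V - {b}) (link F {b} {})) \<le> (\<Sum>b\<in>V. K)"
      by (rule sum_mono) (use small[of "{_}" "{}"] in simp)
    then have "(\<Sum>b\<in>V. mass (V - {b}) (link F {b} {})) / real (card V) \<le> K"
      using K by (cases "card V = 0") (simp_all add: divide_le_eq mult.commute)
    then have "mass V F \<le> K + 1" unfolding mass_by_first_element[OF V F] by simp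
    then show ?thesis using True by simp
  qed
qed

text \<open>The exponent is taken as \<open>4 k\<close>, because \<open>2 ^ (4 k) \<ge> (k + 1) ^ 4\<close> beats any multiple of \<open>(k + 1) ^ 3\<close>.\<close>

lemma exponential_beats_cubic:
  fixes a b c :: real
  assumes "a > 0" "b > 0" "c > 0"
  shows "\<exists>T. 8 * c ^ 3 * (a + b * real T) ^ 3 + 1 < 2 ^ T \<and> 3 \<le> (2::nat) ^ T"
proof -
  define D where "D = 8 * c ^ 3 * (4 * (a + b)) ^ 3 + 1"
  have D1: "D \<ge> 1" unfolding D_def using assms by simp
  obtain k :: nat where k: "D < real k" using reals_Archimedean2 by blast
  define x where "x = real k + 1"
  have x: "D < x" "1 \<le> x" unfolding x_def using k by simp_all
  have "Suc k \<le> 2 ^ k" using less_exp[of k] by (rule Suc_leI)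
  then have "real (Suc k) \<le> real (2 ^ k)" by (simp only: of_nat_le_iff)
  then have xk: "x \<le> 2 ^ k" unfolding x_def by simp
  have "b * (4 * real k) \<le> 4 * b * x" "a \<le> 4 * a * x"
    unfolding x_def using assms mult_nonneg_nonneg[of a "real k"] by (simp_all add: algebra_simps)
  then have "a + b * (4 * real k) \<le> 4 * (a + b) * x" by (simp add: algebra_simps)
  then have "(a + b * (4 * real k)) ^ 3 \<le> (4 * (a + b) * x) ^ 3" using assms by (intro power_mono) auto
  then have "8 * c ^ 3 * (a + b * (4 * real k)) ^ 3 \<le> 8 * c ^ 3 * (4 * (a + b) * x) ^ 3"
    using assms by (intro mult_left_mono) auto
  also have "\<dots> = (D - 1) * x ^ 3" unfolding D_def by (simp add: power_mult_distrib)
  finally have "8 * c ^ 3 * (a + b * (4 * real k)) ^ 3 + 1 \<le> (D - 1) * x ^ 3 + x ^ 3"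
    using x(2) one_le_power[of x 3] by linarith
  also have "\<dots> = D * x ^ 3" by (simp add: algebra_simps)
  also have "\<dots> < x * x ^ 3" using x by (intro mult_strict_right_mono) auto
  also have "\<dots> = x ^ 4" by (simp add: power_eq_if)
  also have "\<dots> \<le> (2 ^ k) ^ 4" using xk x(2) by (intro power_mono) auto
  also have "\<dots> = 2 ^ (4 * k)" by (simp add: power_mult[symmetric] mult.commute)
  finally have "8 * c ^ 3 * (a + b * real (4 * k)) ^ 3 + 1 < 2 ^ (4 * k)" by simp
  moreover have "3 \<le> (2::nat) ^ (4 * k)"
  proof -
    have "k \<ge> 1" using k D1 by simp
    then have "(2::nat) ^ 2 \<le> 2 ^ (4 * k)" by (intro power_increasing) auto
    then show ?thesis by simp
  qed
  ultimately show ?thesis by (intro exI[of _ "4 * k"] conjI)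
qed

text \<open>The number \<open>T\<close> is fixed first, in such a way that the bound \<open>K\<close> it produces satisfies the inequality required in
\<open>mass_lower_half\<close> for \<open>K + 1\<close>. Induction on the dimension then reproduces the same \<open>K\<close>: each half of
the cube contributes at most \<open>K / 2\<close>.\<close>

theorem mass_bounded_of_order_free:
  assumes ord: "natural_order m le"
  shows "\<exists>K::real. \<forall>(V :: 'a set) F. finite V \<longrightarrow> F \<subseteq> Pow V \<longrightarrow> \<not> contains_order m le F \<longrightarrow> mass V F \<le> K"
proof (cases "m = 0")
  case True
  then show ?thesis by (simp add: contains_order_def)
next
  case False
  let ?le' = "dual_order m le"
  have ord': "natural_order m ?le'" using natural_order_dual[OF ord] .
  obtain W1 where W1: "\<forall>(V :: 'a set) F M. finite V \<longrightarrow> F \<subseteq> Pow V \<longrightarrow> \<not> contains_order m le F \<longrightarrow> 1 \<le> M \<longrightarrow>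
           mass V {A\<in>F. M \<le> card A \<and> card A \<le> 2 * M \<and> 2 * card A \<le> card V} \<le> W1"
    using mass_dyadic_window_bounded[OF ord] by (elim exE)
  obtain W2 where W2: "\<forall>(V :: 'a set) F M. finite V \<longrightarrow> F \<subseteq> Pow V \<longrightarrow> \<not> contains_order m ?le' F \<longrightarrow> 1 \<le> M \<longrightarrow>
           mass V {A\<in>F. M \<le> card A \<and> card A \<le> 2 * M \<and> 2 * card A \<le> card V} \<le> W2"
    using mass_dyadic_window_bounded[OF ord'] by (elim exE)
  define W where "W = max 1 (max W1 W2)"
  have W: "W > 0" "W1 \<le> W" "W2 \<le> W" unfolding W_def by auto
  obtain T where T: "8 * real m ^ 3 * ((3 + 4 * real m) + (2 * real m * W) * real T) ^ 3 + 1 < 2 ^ T" "3 \<le> (2::nat) ^ T"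
    using exponential_beats_cubic[of "3 + 4 * real m" "2 * real m * W" "real m"] W False by auto
  define K where "K = 2 * (1 + real m * (2 + real T * W))"
  have K0: "K \<ge> 0" unfolding K_def using W by simp
  have K1: "K + 1 = (3 + 4 * real m) + (2 * real m * W) * real T" unfolding K_def by (simp add: algebra_simps)
  have T': "8 * real m ^ 3 * (K + 1) ^ 3 + 1 < 2 ^ T" using T(1) unfolding K1 .
  have "mass V F \<le> K" if "finite V" "F \<subseteq> Pow V" "\<not> contains_order m le F" for V :: "'a set" and F
    using that
  proof (induction "card V" arbitrary: V F rule: less_induct)
    case less
    note V = less.prems(1) and F = less.prems(2) and free = less.prems(3)
    let ?co = "complements V F"
    have fin: "finite F" using finite_family[OF V F] .
    have coV: "?co \<subseteq> Pow V" unfolding complements_def by auto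
    have free': "\<not> contains_order m ?le' ?co" using contains_order_complements[OF F] free by blast
    have bound: "mass_bounded_on_subcubes V F (K + 1)"
    proof (rule mass_bounded_of_smaller_cubes[OF V F K0])
      fix Y X assume YX: "Y \<subseteq> V" "X \<subseteq> V" "Y \<inter> X = {}" "Y \<union> X \<noteq> {}"
      show "mass (V - (Y \<union> X)) (link F Y X) \<le> K"
      proof (rule less.hyps)
        show "card (V - (Y \<union> X)) < card V" by (rule psubset_card_mono[OF V]) (use YX in auto)
        show "link F Y X \<subseteq> Pow (V - (Y \<union> X))" using link_subset_Pow[OF F] .
        show "\<not> contains_order m le (link F Y X)" using contains_order_link free by blast
      qed (use V in simp)
    qed
    have low: "mass V {A\<in>F. 2 * card A \<le> card V} \<le> K / 2"
    proof -
      have "mass V {A\<in>F. 2 * card A \<le> card V} \<le> 1 + real m * (2 + real T * W)"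
      proof (rule mass_lower_half[OF ord V F free _ _ bound _ T' T(2)])
        fix M :: nat assume "1 \<le> M"
        then show "mass V {A\<in>F. M \<le> card A \<and> card A \<le> 2 * M \<and> 2 * card A \<le> card V} \<le> W"
          using W1 V F free W(2) by (meson order_trans)
      qed (use W K0 in auto)
      then show ?thesis unfolding K_def by simp
    qed
    have high: "mass V {A\<in>?co. 2 * card A \<le> card V} \<le> K / 2"
    proof -
      have "mass V {A\<in>?co. 2 * card A \<le> card V} \<le> 1 + real m * (2 + real T * W)"
      proof (rule mass_lower_half[OF ord' V coV free' _ _ mass_bounded_complements[OF V F bound] _ T' T(2)])
        fix M :: nat assume "1 \<le> M"
        then show "mass V {A\<in>?co. M \<le> card A \<and> card A \<le> 2 * M \<and> 2 * card A \<le> card V} \<le> W"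
          using W2 V coV free' W(3) by (meson order_trans)
      qed (use W K0 in auto)
      then show ?thesis unfolding K_def by simp
    qed
    let ?up = "{A\<in>F. card V \<le> 2 * card A}"
    have "mass V F \<le> mass V ({A\<in>F. 2 * card A \<le> card V} \<union> ?up)"
      by (rule mass_mono) (use fin in auto)
    also have "\<dots> \<le> mass V {A\<in>F. 2 * card A \<le> card V} + mass V ?up" by (rule mass_Un_le) (use fin in auto)
    also have "mass V ?up = mass V (complements V ?up)" by (rule mass_complements[symmetric, OF V]) (use F in auto)
    also have "\<dots> \<le> mass V {A\<in>?co. 2 * card A \<le> card V}"
    proof (rule mass_mono)
      show "finite {A\<in>?co. 2 * card A \<le> card V}" using fin unfolding complements_def by simp
      have "2 * card (V - A) \<le> card V" if "A \<in> ?up" for A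
      proof -
        have "A \<subseteq> V" using that F by auto
        then have "card (V - A) = card V - card A" using V by (simp add: card_Diff_subset finite_subset)
        moreover have "card V \<le> 2 * card A" using that by simp
        ultimately show ?thesis by linarith
      qed
      then show "complements V ?up \<subseteq> {A\<in>?co. 2 * card A \<le> card V}" unfolding complements_def by auto
    qed
    finally show ?case using low high by linarith
  qed
  then show ?thesis by blast
qed

section \<open>Finite posets\<close>

text \<open>Sorting the elements by the sizes of their principal down-sets gives a linear extension.\<close>

lemma finite_poset_labelling:
  fixes P :: "'a set"
  assumes P: "finite P" and r: "partial_order_on P r"
  shows "\<exists>p. bij_betw p {..<card P} P \<and> natural_order (card P) (\<lambda>i j. (p i, p j) \<in> r)"
proof -
  have refl: "\<And>x. x \<in> P \<Longrightarrow> (x, x) \<in> r" and tr: "\<And>x y z. (x, y) \<in> r \<Longrightarrow> (y, z) \<in> r \<Longrightarrow> (x, z) \<in> r"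
    and anti: "\<And>x y. (x, y) \<in> r \<Longrightarrow> (y, x) \<in> r \<Longrightarrow> x = y"
    using partial_order_onD[OF r] by (auto simp: refl_on_def elim: transE antisymD)
  define \<kappa> where "\<kappa> x = card {y\<in>P. (y, x) \<in> r}" for x
  have \<kappa>_less: "\<kappa> x < \<kappa> y" if "x \<in> P" "y \<in> P" "(x, y) \<in> r" "x \<noteq> y" for x y
    unfolding \<kappa>_def
  proof (rule psubset_card_mono)
    have "y \<notin> {z\<in>P. (z, x) \<in> r}" using anti that by blast
    moreover have "y \<in> {z\<in>P. (z, y) \<in> r}" using refl that by blast
    moreover have "{z\<in>P. (z, x) \<in> r} \<subseteq> {z\<in>P. (z, y) \<in> r}" using tr that by blast
    ultimately show "{z\<in>P. (z, x) \<in> r} \<subset> {z\<in>P. (z, y) \<in> r}" by blast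
  qed (use P in simp)
  obtain xs where xs: "set xs = P" "distinct xs" using finite_distinct_list[OF P] by blast
  define ys where "ys = sort_key \<kappa> xs"
  have ys: "set ys = P" "distinct ys" "sorted (map \<kappa> ys)" unfolding ys_def using xs by simp_all
  have len: "length ys = card P" using ys(1,2) distinct_card by metis
  have bij: "bij_betw (\<lambda>i. ys ! i) {..<card P} P" using bij_betw_nth[OF ys(2)] ys(1) len by simp
  have mem: "ys ! i \<in> P" if "i < card P" for i using that len ys(1) nth_mem by metis
  have mono: "i \<le> j" if ij: "i < card P" "j < card P" "(ys ! i, ys ! j) \<in> r" for i j
  proof (rule ccontr)
    assume "\<not> i \<le> j"
    then have "j < i" by simp
    then have "\<kappa> (ys ! j) \<le> \<kappa> (ys ! i)"
      using sorted_nth_mono[OF ys(3), of j i] ij(1,2) len by simp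
    moreover have "ys ! i \<noteq> ys ! j" using nth_eq_iff_index_eq[OF ys(2)] ij(1,2) len \<open>j < i\<close> by simp
    ultimately show False using \<kappa>_less[of "ys ! i" "ys ! j"] mem ij by simp
  qed
  have "natural_order (card P) (\<lambda>i j. (ys ! i, ys ! j) \<in> r)"
    unfolding natural_order_def using refl mem mono tr by blast
  with bij show ?thesis by blast
qed

lemma contains_induced_subposet_of_order:
  assumes p: "bij_betw p {..<m} P" and ord: "natural_order m (\<lambda>i j. (p i, p j) \<in> r)"
    and c: "contains_order m (\<lambda>i j. (p i, p j) \<in> r) F"
  shows "contains_induced_subposet F (inclusion_order F) P r"
proof -
  obtain A where A: "\<forall>i<m. A i \<in> F" "\<forall>i<m. \<forall>j<m. A i \<subseteq> A j \<longleftrightarrow> (p i, p j) \<in> r"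
    using c unfolding contains_order_def by (elim exE conjE)
  define q where "q = inv_into {..<m} p"
  have q: "q x < m" "p (q x) = x" if "x \<in> P" for x
    using that p bij_betw_inv_into_right[OF p] inv_into_into[of x p "{..<m}"]
    unfolding q_def bij_betw_def by auto
  have iff: "A (q x) \<subseteq> A (q y) \<longleftrightarrow> (x, y) \<in> r" if "x \<in> P" "y \<in> P" for x y
    using A(2) q[OF that(1)] q[OF that(2)] by simp
  have "inj_on (\<lambda>x. A (q x)) P"
  proof (rule inj_onI)
    fix x y assume xy: "x \<in> P" "y \<in> P" "A (q x) = A (q y)"
    then have "(x, y) \<in> r" "(y, x) \<in> r" using iff by blast+
    then have "q x \<le> q y" "q y \<le> q x"
      using ord q[OF xy(1)] q[OF xy(2)] unfolding natural_order_def by simp_all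
    then show "x = y" using q(2) xy by (metis le_antisym)
  qed
  moreover have "(\<lambda>x. A (q x)) \<in> P \<rightarrow> F" using A(1) q(1) by auto
  moreover have "\<forall>x\<in>P. \<forall>y\<in>P. (x, y) \<in> r \<longleftrightarrow> (A (q x), A (q y)) \<in> inclusion_order F"
    using iff A(1) q(1) by (simp add: relation_of_def)
  ultimately show ?thesis unfolding contains_induced_subposet_def by (intro exI[of _ "\<lambda>x. A (q x)"]) simp
qed

theorem theorem1p3:
  fixes P :: "'a set" and r :: "'a rel"
  assumes "finite P" and "partial_order_on P r"
  shows "\<exists>c::real. \<forall>(n::nat) F. F \<subseteq> Pow {1..n} \<longrightarrow>
           \<not> contains_induced_subposet F (inclusion_order F) P r \<longrightarrow>
           lubell_mass n F \<le> c"
proof -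
  obtain p where p: "bij_betw p {..<card P} P" "natural_order (card P) (\<lambda>i j. (p i, p j) \<in> r)"
    using finite_poset_labelling[OF assms] by (elim exE conjE)
  obtain K where K: "\<forall>(V :: nat set) F. finite V \<longrightarrow> F \<subseteq> Pow V \<longrightarrow>
      \<not> contains_order (card P) (\<lambda>i j. (p i, p j) \<in> r) F \<longrightarrow> mass V F \<le> K"
    using mass_bounded_of_order_free[OF p(2)] by (elim exE)
  have "lubell_mass n F \<le> K"
    if F: "F \<subseteq> Pow {1..n}" and free: "\<not> contains_induced_subposet F (inclusion_order F) P r" for n F
  proof -
    have "\<not> contains_order (card P) (\<lambda>i j. (p i, p j) \<in> r) F"
      using contains_induced_subposet_of_order[OF p] free by blast
    then have "mass {1..n} F \<le> K" using K F by blast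
    then show ?thesis by (simp add: lubell_mass_def mass_def)
  qed
  then show ?thesis by blast
qed

end
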